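(* Let $\alpha\in\mathcal M_{\mathbb P_+}$ and let $X\in\mathcal M_{p,n}$ be a random matrix such that for any $1$-Lipschitz mapping $f:\mathcal M_{p,n}\to\mathbb R$ and any median $m_f\in\mathbb R$ of $f(X)$, $$S_{|f(X)-m_f|}\le\alpha.$$ Then for all deterministic $A\in\mathcal M_p$, $B\in\mathcal M_n$, denoting by $m_{\mathrm{Tr}}\in\mathbb R$ a median of $\mathrm{Tr}(BX^TAX)$, $$S_{|\mathrm{Tr}(BX^TAX)-m_{\mathrm{Tr}}|}\le2\,\alpha\circ\left(\frac{\mathrm{Id}}{m}\boxplus\sqrt{\frac{\mathrm{Id}}{3\|A\|\|B\|}}\right),$$ where $m\in\mathbb R$ is a median of $2\|A_sXB_s+A_aXB_a\|_F$, with $A=A_s+A_a$, $B=B_s+B_a$, $A_s,B_s$ symmetric and $A_a,B_a$ antisymmetric. In a convex concentration setting (the hypothesis $S_{|f(X)-m_f|}\le\alpha$ being assumed only for the mappings $f$ that are $1$-Lipschitz and convex), the same result is obtained with some numerical constants replacing the "$2$" and the "$3$" in the last inequality.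
   Context: $\mathcal M_{p,n}$ is the space of real $p\times n$ matrices with the Frobenius norm $\|\cdot\|_F$ (Lipschitz is with respect to it), $\mathcal M_p=\mathcal M_{p,p}$, and $\|A\|,\|B\|$ are spectral (operator) norms. A median $m$ of $Y$ satisfies $\mathbb P(Y\ge m),\mathbb P(Y\le m)\ge\frac12$. Operators. An operator is a map $f:\mathbb R\to2^{\mathbb R}$, with graph $\{(x,y):y\in f(x)\}$, $\mathrm{Dom}(f)=\{x:f(x)\ne\emptyset\}$, $\mathrm{Ran}(f)=\bigcup_xf(x)$; its inverse is defined by $x\in f^{-1}(y)\iff y\in f(x)$. $\mathrm{Id}$ is the identity. Sums are pointwise Minkowski sums, $(f\circ g)(x)=\bigcup_{y\in g(x)}f(y)$, $(\lambda f)(x)=\{\lambda y:y\in f(x)\}$. The parallel sum is $f\boxplus g=(f^{-1}+g^{-1})^{-1}$. $f$ is nondecreasing if $(y-x)(v-u)\ge0$ for all $(x,u),(y,v)$ in its graph; nonincreasing if $-f$ is nondecreasing. $\mathcal M_\downarrow$ is the set of nonincreasing operators that are maximally monotone (graph not strictly contained in that of another monotone operator). For $f\in\mathcal M_\downarrow$, $J_f=(\mathrm{Id}-f)^{-1}$ is a single-valued function on $\mathbb R$; for $f,g\in\mathcal M_\downarrow$, $f\le g$ means $J_f\le J_g$ pointwise. $\mathcal M_{\mathbb P_+}$ is the set of $\alpha\in\mathcal M_\downarrow$ with $\mathrm{Dom}(\alpha),\mathrm{Ran}(\alpha)\subset\mathbb R_+$ and such that $\mathrm{Ran}(\alpha)$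 contains an increasing sequence converging to $1$. For a real random variable $Y$, $S_Y(t)=[\mathbb P(Y>t),\mathbb P(Y\ge t)]$. For $\gamma\in\mathcal M_\downarrow$ with $\mathrm{Dom}(\gamma),\mathrm{Ran}(\gamma)\subset\mathbb R_+$, $S_Y\le\gamma$ is equivalent to: $\mathbb P(Y>t)\le u$ for all $t\in\mathrm{Dom}(\gamma)$, $u\in\gamma(t)$. $\mathrm{Id}/m$ is $x\mapsto x/m$ and $\sqrt{\mathrm{Id}}$ is the operator with domain $\mathbb R_+$, $\sqrt{\mathrm{Id}}(t)=\{\sqrt t\}$ for $t>0$ and $\sqrt{\mathrm{Id}}(0)=(-\infty,0]$. Thus for $t>0$ the parallel sum in the conclusion evaluated at $t$ is the unique $s>0$ with $ms+3\|A\|\|B\|s^2=t$. If $m=0$ or $\|A\|\|B\|=0$ the corresponding term is omitted (if both vanish the right-hand side is read as $0$ for $t>0$).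
   Formalization: In the convex setting the numerical constant replacing the "2" in front of α also replaces the "2" in the definition of m as a median of 2‖A_sXB_s+A_aXB_a‖_F; with that "2" kept the convex claim is false. *)

theory Defs
  imports "HOL-Probability.Probability" "Jordan_Normal_Form.Matrix"
begin

section \<open>Operators on the real line\<close>

type_synonym operator = "real \<Rightarrow> real set"

definition graph :: "operator \<Rightarrow> (real \<times> real) set" where
  "graph f = {(x, y). y \<in> f x}"

definition op_Dom :: "operator \<Rightarrow> real set" where
  "op_Dom f = {x. f x \<noteq> {}}"

definition op_Ran :: "operator \<Rightarrow> real set" where
  "op_Ran f = (\<Union>x. f x)"

definition op_inv :: "operator \<Rightarrow> operator" where
  "op_inv f = (\<lambda>y. {x. y \<in> f x})"

definition op_id :: operator where
  "op_id = (\<lambda>x. {x})"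

definition op_add :: "operator \<Rightarrow> operator \<Rightarrow> operator" where
  "op_add f g = (\<lambda>x. {a + b |a b. a \<in> f x \<and> b \<in> g x})"

definition op_scale :: "real \<Rightarrow> operator \<Rightarrow> operator" where
  "op_scale c f = (\<lambda>x. {c * y |y. y \<in> f x})"

definition op_comp :: "operator \<Rightarrow> operator \<Rightarrow> operator" where
  "op_comp f g = (\<lambda>x. \<Union>y\<in>g x. f y)"

definition parallel_sum :: "operator \<Rightarrow> operator \<Rightarrow> operator" where
  "parallel_sum f g = op_inv (op_add (op_inv f) (op_inv g))"

definition op_nondecreasing :: "operator \<Rightarrow> bool" where
  "op_nondecreasing f \<longleftrightarrow>
     (\<forall>x u y v. (x, u) \<in> graph f \<longrightarrow> (y, v) \<in> graph f \<longrightarrow> (y - x) * (v - u) \<ge> 0)"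

definition op_nonincreasing :: "operator \<Rightarrow> bool" where
  "op_nonincreasing f \<longleftrightarrow> op_nondecreasing (op_scale (-1) f)"

definition op_monotone :: "operator \<Rightarrow> bool" where
  "op_monotone f \<longleftrightarrow> op_nondecreasing f \<or> op_nonincreasing f"

definition maximally_monotone :: "operator \<Rightarrow> bool" where
  "maximally_monotone f \<longleftrightarrow> op_monotone f \<and> (\<nexists>g. op_monotone g \<and> graph f \<subset> graph g)"

definition M_down :: "operator set" where
  "M_down = {f. op_nonincreasing f \<and> maximally_monotone f}"

text \<open>The function \<open>J_f = (Id - f)\<^sup>-\<^sup>1\<close>; the description is meaningful for \<open>f \<in> M_down\<close>,
  where the operator is single-valued with full domain.\<close>

definition resolvent :: "operator \<Rightarrow> real \<Rightarrow> real" where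
  "resolvent f x = (THE y. y \<in> op_inv (op_add op_id (op_scale (-1) f)) x)"

definition op_le :: "operator \<Rightarrow> operator \<Rightarrow> bool" where
  "op_le f g \<longleftrightarrow> f \<in> M_down \<and> g \<in> M_down \<and> (\<forall>x. resolvent f x \<le> resolvent g x)"

definition M_prob :: "operator set" where
  "M_prob = {\<alpha> \<in> M_down. op_Dom \<alpha> \<subseteq> {0..} \<and> op_Ran \<alpha> \<subseteq> {0..} \<and>
     (\<exists>q :: nat \<Rightarrow> real. strict_mono q \<and> range q \<subseteq> op_Ran \<alpha> \<and> q \<longlonglongrightarrow> 1)}"

definition op_id_div :: "real \<Rightarrow> operator" where
  "op_id_div m = (\<lambda>x. {x / m})"

definition op_sqrt :: operator where
  "op_sqrt = (\<lambda>t. if t > 0 then {sqrt t} else if t = 0 then {..0} else {})"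

text \<open>\<open>bound_op \<kappa> \<alpha> m c\<close> is \<open>\<kappa> \<alpha> \<circ> (Id/m \<boxplus> sqrt (Id/c))\<close>, where the term with a vanishing
  parameter is omitted.  When both vanish the bound is zero on positive arguments;
  the operator in \<open>M_down\<close> with this property and domain, range in the nonnegative
  reals has the half-line \<open>{0..}\<close> as its value at 0.\<close>

definition bound_op :: "real \<Rightarrow> operator \<Rightarrow> real \<Rightarrow> real \<Rightarrow> operator" where
  "bound_op \<kappa> \<alpha> m c =
     (if m = 0 \<and> c = 0 then (\<lambda>t. if t > 0 then {0} else if t = 0 then {0..} else {})
      else if m = 0 then op_scale \<kappa> (op_comp \<alpha> (op_comp op_sqrt (op_id_div c)))
      else if c = 0 then op_scale \<kappa> (op_comp \<alpha> (op_id_div m))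
      else op_scale \<kappa> (op_comp \<alpha>
             (parallel_sum (op_id_div m) (op_comp op_sqrt (op_id_div c)))))"


section \<open>Random variables\<close>

definition surv :: "'w measure \<Rightarrow> ('w \<Rightarrow> real) \<Rightarrow> operator" where
  "surv M Y = (\<lambda>t. {measure M {w \<in> space M. Y w > t} .. measure M {w \<in> space M. Y w \<ge> t}})"

definition is_median :: "'w measure \<Rightarrow> ('w \<Rightarrow> real) \<Rightarrow> real \<Rightarrow> bool" where
  "is_median M Y m \<longleftrightarrow>
     measure M {w \<in> space M. Y w \<ge> m} \<ge> 1 / 2 \<and> measure M {w \<in> space M. Y w \<le> m} \<ge> 1 / 2"


section \<open>Matrices\<close>

text \<open>Dimensions are natural numbers (not types), since numerical constants that do not depend
  on the dimensions have to be quantified before them.\<close>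

definition mat_trace :: "real mat \<Rightarrow> real" where
  "mat_trace A = (\<Sum>i<dim_row A. A $$ (i, i))"

definition frobenius_norm :: "real mat \<Rightarrow> real" where
  "frobenius_norm A = sqrt (\<Sum>i<dim_row A. \<Sum>j<dim_col A. (A $$ (i, j))\<^sup>2)"

definition euclidean_norm :: "real vec \<Rightarrow> real" where
  "euclidean_norm v = sqrt (scalar_prod v v)"

definition spectral_norm :: "real mat \<Rightarrow> real" where
  "spectral_norm A =
     (SUP v \<in> {v \<in> carrier_vec (dim_col A). euclidean_norm v \<le> 1}. euclidean_norm (A *\<^sub>v v))"

definition lipschitz1_mat :: "nat \<Rightarrow> nat \<Rightarrow> (real mat \<Rightarrow> real) \<Rightarrow> bool" where
  "lipschitz1_mat p n f \<longleftrightarrow>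
     (\<forall>x \<in> carrier_mat p n. \<forall>y \<in> carrier_mat p n. \<bar>f x - f y\<bar> \<le> frobenius_norm (x - y))"

definition convex_mat :: "nat \<Rightarrow> nat \<Rightarrow> (real mat \<Rightarrow> real) \<Rightarrow> bool" where
  "convex_mat p n f \<longleftrightarrow>
     (\<forall>x \<in> carrier_mat p n. \<forall>y \<in> carrier_mat p n. \<forall>u \<ge> 0. \<forall>v \<ge> 0. u + v = 1 \<longrightarrow>
        f (u \<cdot>\<^sub>m x + v \<cdot>\<^sub>m y) \<le> u * f x + v * f y)"

definition random_matrix :: "'w measure \<Rightarrow> nat \<Rightarrow> nat \<Rightarrow> ('w \<Rightarrow> real mat) \<Rightarrow> bool" where
  "random_matrix M p n X \<longleftrightarrow>
     prob_space M \<and> (\<forall>w \<in> space M. X w \<in> carrier_mat p n) \<and>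
     (\<forall>i<p. \<forall>j<n. (\<lambda>w. X w $$ (i, j)) \<in> borel_measurable M)"

definition concentrated ::
    "'w measure \<Rightarrow> ('w \<Rightarrow> real mat) \<Rightarrow> (real mat \<Rightarrow> real) set \<Rightarrow> operator \<Rightarrow> bool" where
  "concentrated M X F \<alpha> \<longleftrightarrow>
     (\<forall>f \<in> F. \<forall>m. is_median M (\<lambda>w. f (X w)) m \<longrightarrow>
        op_le (surv M (\<lambda>w. \<bar>f (X w) - m\<bar>)) \<alpha>)"

text \<open>The conclusion for \<open>Tr (B X\<^sup>T A X)\<close>, with \<open>\<kappa>\<close> in the place of both occurrences of the
  constant 2 (in front of \<open>\<alpha>\<close> and in front of the Frobenius norm) and \<open>\<mu>\<close> in the place of 3.
  The factor in front of the Frobenius norm cannot stay equal to 2 in the convex setting.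
  Take \<open>X = (r U, r' U')\<close> with \<open>r = sqrt d + a\<close>, \<open>r' = sqrt d - a\<close>, where \<open>U, U'\<close> are independent and
  uniform on the unit sphere of dimension \<open>d\<close>, \<open>a\<close> is independent of them and centred Gaussian with
  standard deviation \<open>K\<close>, \<open>1 << K << sqrt d\<close>, and \<open>A = diag (I, -I)\<close>, \<open>B = 1\<close>.  Convex 1-Lipschitz
  functions of \<open>X\<close> deviate essentially no more than \<open>a\<close>, but \<open>Tr (X\<^sup>T A X) = 4 sqrt d a\<close>
  deviates like \<open>sqrt 2 m a\<close>, where \<open>m\<close> is about \<open>2 sqrt (2 d)\<close>.\<close>

definition trace_concentrated ::
    "'w measure \<Rightarrow> nat \<Rightarrow> nat \<Rightarrow> ('w \<Rightarrow> real mat) \<Rightarrow> operator \<Rightarrow> real \<Rightarrow> real \<Rightarrow> bool" where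
  "trace_concentrated M p n X \<alpha> \<kappa> \<mu> \<longleftrightarrow>
     (\<forall>A \<in> carrier_mat p p. \<forall>B \<in> carrier_mat n n.
      \<forall>As \<in> carrier_mat p p. \<forall>Aa \<in> carrier_mat p p.
      \<forall>Bs \<in> carrier_mat n n. \<forall>Ba \<in> carrier_mat n n. \<forall>mTr m.
        A = As + Aa \<longrightarrow> transpose_mat As = As \<longrightarrow> transpose_mat Aa = - Aa \<longrightarrow>
        B = Bs + Ba \<longrightarrow> transpose_mat Bs = Bs \<longrightarrow> transpose_mat Ba = - Ba \<longrightarrow>
        is_median M (\<lambda>w. mat_trace (B * transpose_mat (X w) * A * X w)) mTr \<longrightarrow>
        is_median M (\<lambda>w. \<kappa> * frobenius_norm (As * X w * Bs + Aa * X w * Ba)) m \<longrightarrow>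
        op_le (surv M (\<lambda>w. \<bar>mat_trace (B * transpose_mat (X w) * A * X w) - mTr\<bar>))
              (bound_op \<kappa> \<alpha> m (\<mu> * spectral_norm A * spectral_norm B)))"

end

theory Submission
  imports Defs
begin

text \<open>Write \<open>\<phi> x = Tr (B x\<^sup>T A x)\<close>, \<open>K = \<parallel>A\<parallel> \<parallel>B\<parallel>\<close> and let \<open>\<psi>\<close> be the norm of the gradient
  \<open>2 (A\<^sub>s x B\<^sub>s + A\<^sub>a x B\<^sub>a)\<close>.  Since \<open>\<phi>\<close> is quadratic, \<open>\<bar>\<phi> y - \<phi> x\<bar> \<le> \<psi> x d + K d\<^sup>2\<close> with \<open>d\<close> the
  distance of \<open>x\<close> and \<open>y\<close>, and \<open>\<psi> / (2 K)\<close> is convex and 1-Lipschitz.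

  In the Lipschitz setting, the signed distance \<open>f\<close> to the level set of \<open>\<phi>\<close> at its median is 1-Lipschitz
  with median 0.  Where \<open>\<bar>f\<bar> \<le> s\<close> and \<open>\<psi> \<le> m + 2 K s\<close>, the deviation of \<open>\<phi>\<close> is at most
  \<open>(m + 2 K s) s + K s\<^sup>2 = m s + 3 K s\<^sup>2\<close>; each of the two exceptional events has probability at most
  \<open>\<alpha> s\<close>.

  In the convex setting, \<open>\<phi>\<close> is diagonalized and split into its positive and negative part.  A convex
  part deviates upwards only far from its sublevel set at the median.  Downward deviations, intersected
  with the convex set \<open>{\<psi> \<le> m + 2 K s}\<close>, form a convex set at distance more than \<open>s\<close> from
  half of the mass.  This controls \<open>\<phi>\<close> around the difference of the two medians up to probability
  \<open>5 \<alpha> s\<close>; replacing the centre by the median of \<open>\<phi>\<close> doubles the deviation when \<open>5 \<alpha> s < 1/2\<close>,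
  and otherwise the bound with the constant 10 is trivial.\<close>

section \<open>Maximally monotone operators\<close>

lemma op_nonincreasing_iff:
  "op_nonincreasing f \<longleftrightarrow> (\<forall>x y. \<forall>u\<in>f x. \<forall>v\<in>f y. (y - x) * (v - u) \<le> 0)"
proof -
  have sign: "(y - x) * (- 1 * v - - 1 * u) \<ge> 0 \<longleftrightarrow> (y - x) * (v - u) \<le> 0" for x y u v :: real
    by (simp add: algebra_simps)
  have "op_nonincreasing f \<longleftrightarrow>
      (\<forall>x y. \<forall>u\<in>f x. \<forall>v\<in>f y. (y - x) * (- 1 * v - - 1 * u) \<ge> 0)"
    unfolding op_nonincreasing_def op_nondecreasing_def op_scale_def graph_def mem_Collect_eq prod.case
    by blast
  then show ?thesis unfolding sign .
qed

lemma M_down_nonincreasing: "f \<in> M_down \<Longrightarrow> u \<in> f x \<Longrightarrow> v \<in> f y \<Longrightarrow> (y - x) * (v - u) \<le> 0"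
  unfolding M_down_def using op_nonincreasing_iff by blast

text \<open>Maximality in pointwise form: a point monotonically related to the whole graph can be
  adjoined without losing monotonicity, so it already lies in the graph.\<close>

lemma M_down_complete:
  assumes f: "f \<in> M_down" and rel: "\<And>a b. b \<in> f a \<Longrightarrow> (a - t) * (b - v) \<le> 0"
  shows "v \<in> f t"
proof (rule ccontr)
  assume nv: "v \<notin> f t"
  define g where "g = f(t := insert v (f t))"
  have rel': "(t - a) * (v - b) \<le> 0" if "b \<in> f a" for a b
    using rel[OF that] by (simp add: algebra_simps)
  have "op_nonincreasing g"
    unfolding op_nonincreasing_iff g_def
    using M_down_nonincreasing[OF f] rel rel' by auto
  moreover have "graph f \<subset> graph g"
    using nv by (auto simp: graph_def g_def)
  ultimately show False
    using f unfolding M_down_def maximally_monotone_def op_monotone_def by blast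
qed

text \<open>Minty's theorem on the line. The point \<open>(y, y - x)\<close> is related to
  \<open>(a, b)\<close> iff \<open>y\<close> lies between \<open>a\<close> and \<open>x + b\<close>;
  by monotonicity each such lower end is below each such upper end, so the supremum of the lower
  ends works. Completeness is assumed in place of membership in \<open>M_down\<close> because
  \<open>M_downI\<close> uses the lemma to establish that membership.\<close>

lemma minty_point:
  assumes mono: "op_nonincreasing f"
    and complete: "\<And>t v. (\<And>a b. b \<in> f a \<Longrightarrow> (a - t) * (b - v) \<le> 0) \<Longrightarrow> v \<in> f t"
  shows "\<exists>y. y - x \<in> f y"
proof -
  define S where "S = {min a (x + b) | a b. b \<in> f a}"
  have ub: "s \<le> max a (x + b)" if s: "s \<in> S" and b: "b \<in> f a" for s a b
  proof -
    obtain a' b' where s': "s = min a' (x + b')" "b' \<in> f a'" using s unfolding S_def by auto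
    have "(a - a') * (b - b') \<le> 0" using mono s'(2) b unfolding op_nonincreasing_iff by blast
    then have "a' \<le> a \<or> b' \<le> b" by (metis mult_neg_neg not_le_imp_less diff_less_0_iff_less not_less)
    then show ?thesis using s'(1) by auto
  qed
  have "\<exists>a b. b \<in> f a" using complete by blast
  then obtain a0 b0 where ab0: "b0 \<in> f a0" by blast
  have ne: "S \<noteq> {}" using ab0 unfolding S_def by auto
  have bdd: "bdd_above S" by (rule bdd_aboveI[of _ "max a0 (x + b0)"]) (rule ub[OF _ ab0])
  define y where "y = Sup S"
  have "(a - y) * (b - (y - x)) \<le> 0" if b: "b \<in> f a" for a b
  proof -
    have "y \<le> max a (x + b)" unfolding y_def using ub[OF _ b] by (intro cSup_least ne)
    moreover have "min a (x + b) \<le> y"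
      unfolding y_def by (rule cSup_upper[OF _ bdd]) (use b S_def in blast)
    ultimately have "(a \<le> y \<and> y - x \<le> b) \<or> (y \<le> a \<and> b \<le> y - x)" by linarith
    then show ?thesis by (auto intro: mult_nonpos_nonneg mult_nonneg_nonpos)
  qed
  then show ?thesis using complete by blast
qed

text \<open>Maximality refers to all monotone extensions, so a nondecreasing extension
  \<open>g\<close> has to be excluded as well. It would make \<open>f\<close> monotone in both
  directions, so that any two points of its graph share a coordinate, while
  \<open>minty_point\<close> puts a point of the graph on every line of slope 1.\<close>

lemma M_downI:
  assumes mono: "op_nonincreasing f"
    and complete: "\<And>t v. (\<And>a b. b \<in> f a \<Longrightarrow> (a - t) * (b - v) \<le> 0) \<Longrightarrow> v \<in> f t"
  shows "f \<in> M_down"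
proof -
  have "\<not> op_monotone g" if sub: "graph f \<subset> graph g" for g
  proof
    assume g: "op_monotone g"
    have fg: "b \<in> g a" if "b \<in> f a" for a b using sub that unfolding graph_def by auto
    obtain a b where ab: "b \<in> g a" "b \<notin> f a" using sub unfolding graph_def by auto
    show False
    proof (cases "op_nonincreasing g")
      case True
      then have "b \<in> f a" using fg ab(1) unfolding op_nonincreasing_iff
        by (intro complete) blast
      then show False using ab(2) by simp
    next
      case False
      then have nd: "(y - x) * (v - u) \<ge> 0" if "u \<in> g x" "v \<in> g y" for x y u v
        using g that unfolding op_monotone_def op_nondecreasing_def graph_def by auto
      have ni: "(y - x) * (v - u) \<le> 0" if "u \<in> f x" "v \<in> f y" for x y u v
        using mono that unfolding op_nonincreasing_iff by auto
      have zero: "y = x \<or> v = u" if "u \<in> f x" "v \<in> f y" for x y u v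
        using ni[OF that] nd[OF fg[OF that(1)] fg[OF that(2)]]
        by (metis antisym eq_iff_diff_eq_0 mult_eq_0_iff)
      \<comment> \<open>Lines of slope 1 are parametrised from the missing point
        \<open>(a, b)\<close>. The line through it carries \<open>(a + d, b + d)\<close> with
        \<open>d \<noteq> 0\<close>; those shifted vertically by \<open>-2*d\<close> and
        \<open>2*d\<close> then have to carry \<open>(a + 3*d, b + d)\<close> and
        \<open>(a + d, b + 3*d)\<close>, which share no coordinate.\<close>
      have line: "\<exists>r. b + r - e \<in> f (a + r)" for e
        using minty_point[of f "a - b + e", OF mono complete] by (auto simp: algebra_simps) (metis diff_add_cancel add.commute diff_diff_eq2)
      obtain d where d: "b + d \<in> f (a + d)" using line[of 0] by auto
      have d0: "d \<noteq> 0" using ab(2) d by auto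
      obtain r1 where r1: "b + r1 - 2*d \<in> f (a + r1)" using line[of "2*d"] by auto
      obtain r2 where r2: "b + r2 + 2*d \<in> f (a + r2)" using line[of "-2*d"] by auto
      have sq: "d * d > 0" using d0 by (auto simp: zero_less_mult_iff)
      have r1': "r1 = 3 * d"
      proof (rule ccontr)
        assume "r1 \<noteq> 3 * d"
        then have "r1 = d" using zero[OF d r1] by auto
        then show False using nd[OF ab(1) fg[OF r1]] sq by (simp add: algebra_simps)
      qed
      have r2': "r2 = d"
      proof (rule ccontr)
        assume "r2 \<noteq> d"
        then have "r2 = - d" using zero[OF d r2] by auto
        then show False using nd[OF ab(1) fg[OF r2]] sq by (simp add: algebra_simps)
      qed
      show False using zero[OF r1 r2] d0 unfolding r1' r2' by auto
    qed
  qed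
  then show ?thesis
    using mono unfolding M_down_def maximally_monotone_def op_monotone_def by auto
qed

lemma M_down_minty: "f \<in> M_down \<Longrightarrow> \<exists>y. y - x \<in> f y"
  by (rule minty_point) (use M_down_complete in \<open>simp add: M_down_def, blast\<close>)

text \<open>Monotonicity makes the description in \<open>resolvent\<close> unique: two solutions
  satisfy \<open>(z - y) * (z - y) \<le> 0\<close>.\<close>

lemma resolvent_eq:
  assumes "f \<in> M_down" "y - x \<in> f y"
  shows "resolvent f x = y"
proof -
  have iff: "z \<in> op_inv (op_add op_id (op_scale (-1) f)) x \<longleftrightarrow> z - x \<in> f z" for z
  proof -
    have "z \<in> op_inv (op_add op_id (op_scale (-1) f)) x \<longleftrightarrow> (\<exists>b. x = z - b \<and> b \<in> f z)"
      unfolding op_inv_def op_add_def op_id_def op_scale_def by auto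
    moreover have "x = z - b \<longleftrightarrow> b = z - x" for b by auto
    ultimately show ?thesis by simp
  qed
  have "z = y" if "z - x \<in> f z" for z
  proof -
    have "(z - y) * (z - y) \<le> 0" using M_down_nonincreasing[OF assms(1,2) that] by simp
    then show ?thesis by (metis eq_iff_diff_eq_0 mult_eq_0_iff zero_le_square antisym)
  qed
  then show ?thesis unfolding resolvent_def iff using assms(2) by blast
qed

section \<open>Survival operators and the order on \<open>M_down\<close>\<close>

lemma (in finite_measure) nonincreasing_surv:
  assumes [measurable]: "Y \<in> borel_measurable M"
  shows "op_nonincreasing (surv M Y)"
proof -
  have anti: "v \<le> u" if "u \<in> surv M Y x" "v \<in> surv M Y y" "x < y" for x y u v
  proof -
    have "v \<le> measure M {w \<in> space M. Y w \<ge> y}" using that(2) by (simp add: surv_def)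
    also have "\<dots> \<le> measure M {w \<in> space M. Y w > x}"
      using that(3) by (intro finite_measure_mono) auto
    also have "\<dots> \<le> u" using that(1) by (simp add: surv_def)
    finally show ?thesis .
  qed
  then have "(y - x) * (v - u) \<le> 0" if "u \<in> surv M Y x" "v \<in> surv M Y y" for x y u v
  proof (cases x y rule: linorder_cases)
    case less
    then show ?thesis using anti[OF that]
      by (simp add: mult_le_0_iff)
  next
    case greater
    then show ?thesis using anti[OF that(2,1)]
      by (simp add: mult_le_0_iff)
  qed simp
  then show ?thesis unfolding op_nonincreasing_iff by blast
qed

text \<open>The intervals in \<open>surv\<close> fill the jumps of the tail function. A point
  \<open>(t, v)\<close> related to the graph has \<open>v\<close> above the tails at
  \<open>a > t\<close> and below those at \<open>a < t\<close>; continuity of the measure as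
  \<open>a\<close> tends to \<open>t\<close> gives the two ends of the interval at
  \<open>t\<close>.\<close>

lemma (in prob_space) surv_M_down:
  assumes Y[measurable]: "Y \<in> borel_measurable M"
  shows "surv M Y \<in> M_down"
proof (rule M_downI[OF nonincreasing_surv[OF Y]])
  fix t v assume rel: "\<And>a b. b \<in> surv M Y a \<Longrightarrow> (a - t) * (b - v) \<le> 0"
  have up: "measure M {w \<in> space M. Y w > a} \<le> v" if "a > t" for a
  proof -
    have "measure M {w \<in> space M. Y w > a} \<in> surv M Y a"
      unfolding surv_def by (auto intro!: finite_measure_mono)
    from rel[OF this] that show ?thesis by (simp add: mult_le_0_iff)
  qed
  have lo: "v \<le> measure M {w \<in> space M. Y w \<ge> a}" if "a < t" for a
  proof -
    have "measure M {w \<in> space M. Y w \<ge> a} \<in> surv M Y a"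
      unfolding surv_def by (auto intro!: finite_measure_mono)
    from rel[OF this] that show ?thesis by (simp add: mult_le_0_iff)
  qed
  have "(\<lambda>k. measure M {w \<in> space M. Y w > t + 1 / real (Suc k)})
      \<longlonglongrightarrow> measure M (\<Union>k. {w \<in> space M. Y w > t + 1 / real (Suc k)})"
  proof (rule finite_Lim_measure_incseq)
    have "t + 1 / real (Suc n) \<le> t + 1 / real (Suc m)" if "m \<le> n" for m n
      using that by (simp add: frac_le)
    then show "incseq (\<lambda>k. {w \<in> space M. Y w > t + 1 / real (Suc k)})"
      unfolding incseq_def by (force intro: order.strict_trans1 simp del: of_nat_Suc)
  qed auto
  also have "(\<Union>k. {w \<in> space M. Y w > t + 1 / real (Suc k)}) = {w \<in> space M. Y w > t}"
  proof -
    have "(\<exists>k. y > t + 1 / real (Suc k)) \<longleftrightarrow> y > t" for y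
      using reals_Archimedean[of "y - t"]
      by (smt (verit) divide_pos_pos of_nat_0_less_iff zero_less_Suc inverse_eq_divide)
    then show ?thesis by auto
  qed
  finally have 1: "measure M {w \<in> space M. Y w > t} \<le> v"
    by (rule LIMSEQ_le_const2) (use up in \<open>auto intro!: exI[of _ 0]\<close>)
  have "(\<lambda>k. measure M {w \<in> space M. Y w \<ge> t - 1 / real (Suc k)})
      \<longlonglongrightarrow> measure M (\<Inter>k. {w \<in> space M. Y w \<ge> t - 1 / real (Suc k)})"
  proof (rule finite_Lim_measure_decseq)
    have "t - 1 / real (Suc m) \<le> t - 1 / real (Suc n)" if "m \<le> n" for m n
      using that by (simp add: frac_le)
    then show "decseq (\<lambda>k. {w \<in> space M. Y w \<ge> t - 1 / real (Suc k)})"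
      unfolding decseq_def by (force intro: order_trans simp del: of_nat_Suc)
  qed auto
  also have "(\<Inter>k. {w \<in> space M. Y w \<ge> t - 1 / real (Suc k)}) = {w \<in> space M. Y w \<ge> t}"
  proof -
    have "(\<forall>k. y \<ge> t - 1 / real (Suc k)) \<longleftrightarrow> y \<ge> t" for y
      using reals_Archimedean[of "t - y"]
      by (smt (verit) divide_pos_pos of_nat_0_less_iff zero_less_Suc inverse_eq_divide)
    then show ?thesis by auto
  qed
  finally have 2: "v \<le> measure M {w \<in> space M. Y w \<ge> t}"
    by (rule LIMSEQ_le_const) (use lo in \<open>auto intro!: exI[of _ 0]\<close>)
  show "v \<in> surv M Y t" using 1 2 unfolding surv_def by auto
qed

text \<open>Turns the comparison of resolvents into a tail bound. \<open>resolvent f x\<close> is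
  the abscissa where the graph of \<open>f\<close> meets the line of points
  \<open>(y, y - x)\<close>, and for decreasing graphs meeting such lines further left means lying
  below.\<close>

lemma (in prob_space) op_le_surv_iff:
  assumes Y[measurable]: "Y \<in> borel_measurable M" and g: "\<gamma> \<in> M_down"
  shows "op_le (surv M Y) \<gamma> \<longleftrightarrow> (\<forall>t. \<forall>u\<in>\<gamma> t. measure M {w \<in> space M. Y w > t} \<le> u)"
proof
  note S = surv_M_down[OF Y]
  assume le: "op_le (surv M Y) \<gamma>"
  show "\<forall>t. \<forall>u\<in>\<gamma> t. measure M {w \<in> space M. Y w > t} \<le> u"
  proof (intro allI ballI)
    fix t u assume u: "u \<in> \<gamma> t"
    obtain y where y: "y - (t - u) \<in> surv M Y y" using M_down_minty[OF S] by blast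
    have "resolvent \<gamma> (t - u) = t" by (rule resolvent_eq[OF g]) (use u in simp)
    then have yt: "y \<le> t"
      using le resolvent_eq[OF S y] unfolding op_le_def by metis
    have "measure M {w \<in> space M. Y w > t} \<le> measure M {w \<in> space M. Y w > y}"
      using yt by (intro finite_measure_mono) auto
    also have "\<dots> \<le> y - (t - u)" using y by (simp add: surv_def)
    finally show "measure M {w \<in> space M. Y w > t} \<le> u" using yt by simp
  qed
next
  note S = surv_M_down[OF Y]
  assume tail: "\<forall>t. \<forall>u\<in>\<gamma> t. measure M {w \<in> space M. Y w > t} \<le> u"
  have "resolvent (surv M Y) x \<le> resolvent \<gamma> x" for x
  proof -
    obtain t where t: "t - x \<in> \<gamma> t" using M_down_minty[OF g] by blast
    obtain y where y: "y - x \<in> surv M Y y" using M_down_minty[OF S] by blast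
    have "y \<le> t"
    proof (rule ccontr)
      assume "\<not> y \<le> t"
      then have yt: "t < y" by simp
      have "y - x \<le> measure M {w \<in> space M. Y w \<ge> y}" using y by (simp add: surv_def)
      also have "\<dots> \<le> measure M {w \<in> space M. Y w > t}"
        using yt by (intro finite_measure_mono) auto
      also have "\<dots> \<le> t - x" using tail t by auto
      finally show False using yt by simp
    qed
    then show ?thesis using resolvent_eq[OF S y] resolvent_eq[OF g t] by simp
  qed
  then show "op_le (surv M Y) \<gamma>" using S g unfolding op_le_def by auto
qed

section \<open>The operator in the bound\<close>

lemma parallel_sum_sqrt:
  assumes m: "m > 0" and c: "c > 0"
  shows "s \<in> parallel_sum (op_id_div m) (op_comp op_sqrt (op_id_div c)) t
    \<longleftrightarrow> (if s \<ge> 0 then t = m * s + c * s\<^sup>2 else t = m * s)"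
proof -
  have 1: "a \<in> op_inv (op_id_div m) s \<longleftrightarrow> a = m * s" for a
    using m by (auto simp: op_inv_def op_id_div_def field_simps)
  \<comment> \<open>The branch \<open>s < 0\<close> comes from the value \<open>{..0}\<close> of
    \<open>op_sqrt\<close> at 0, which makes the inverse single-valued on the whole line.\<close>
  have 2: "b \<in> op_inv (op_comp op_sqrt (op_id_div c)) s \<longleftrightarrow> b = (if s \<ge> 0 then c * s\<^sup>2 else 0)" for b
  proof -
    have "s = sqrt (b / c) \<Longrightarrow> b > 0 \<Longrightarrow> b = c * s\<^sup>2" using c by simp
    moreover have "s > 0 \<Longrightarrow> sqrt (c * s\<^sup>2 / c) = s" using c by simp
    ultimately show ?thesis using c
      by (auto simp: op_inv_def op_comp_def op_sqrt_def op_id_div_def zero_less_divide_iff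
          split: if_splits)
  qed
  have "s \<in> parallel_sum (op_id_div m) (op_comp op_sqrt (op_id_div c)) t \<longleftrightarrow>
     (\<exists>a b. t = a + b \<and> a \<in> op_inv (op_id_div m) s \<and> b \<in> op_inv (op_comp op_sqrt (op_id_div c)) s)"
    unfolding parallel_sum_def op_inv_def[where f="op_add _ _"] by (simp add: op_add_def)
  then show ?thesis unfolding 1 2 by auto
qed

lemma bound_op_iff:
  assumes dom: "op_Dom \<alpha> \<subseteq> {0..}" and m: "m \<ge> 0" and c: "c \<ge> 0" and ne: "m \<noteq> 0 \<or> c \<noteq> 0"
  shows "v \<in> bound_op \<kappa> \<alpha> m c t \<longleftrightarrow> (\<exists>s\<ge>0. t = m * s + c * s\<^sup>2 \<and> (\<exists>u\<in>\<alpha> s. v = \<kappa> * u))"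
proof -
  have dom': "u \<in> \<alpha> s \<Longrightarrow> s \<ge> 0" for u s using dom unfolding op_Dom_def by auto
  consider (sum) "m > 0" "c > 0" | (sqrt) "m = 0" "c > 0" | (lin) "m > 0" "c = 0"
    using m c ne by linarith
  then show ?thesis
  proof cases
    case sum
    then show ?thesis using parallel_sum_sqrt[OF sum]
      unfolding bound_op_def
      by (auto simp: op_scale_def op_comp_def[of \<alpha>]) (use dom' in \<open>force+\<close>)
  next
    case sqrt
    have "s \<in> op_comp op_sqrt (op_id_div c) t \<and> s \<ge> 0 \<longleftrightarrow> s \<ge> 0 \<and> t = c * s\<^sup>2" for s
      using sqrt(2)
      by (auto simp: op_comp_def op_sqrt_def op_id_div_def zero_less_divide_iff zero_less_mult_iff
          split: if_splits)
    then show ?thesis using sqrt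
      unfolding bound_op_def by (auto simp: op_scale_def op_comp_def[of \<alpha>]) (blast dest: dom')+
  next
    case lin
    then have "t / m = s \<longleftrightarrow> t = m * s" for s by (auto simp: field_simps)
    then show ?thesis using lin
      unfolding bound_op_def by (auto simp: op_scale_def op_comp_def op_id_div_def dest: dom')
  qed
qed

text \<open>Away from the degenerate case \<open>\<tau>\<close> is a strictly increasing bijection
  of the nonnegative half-line, so substituting its inverse into \<open>\<alpha>\<close> and scaling
  by \<open>\<kappa> > 0\<close> keep monotonicity and maximality.\<close>

lemma bound_op_M_down:
  assumes \<alpha>: "\<alpha> \<in> M_down" and dom: "op_Dom \<alpha> \<subseteq> {0..}"
    and m: "m \<ge> 0" and c: "c \<ge> 0" and k: "\<kappa> > 0"
  shows "bound_op \<kappa> \<alpha> m c \<in> M_down"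
proof (cases "m = 0 \<and> c = 0")
  case True
  define f :: operator where "f = (\<lambda>t. if t > 0 then {0} else if t = 0 then {0..} else {})"
  have "f \<in> M_down"
  proof (rule M_downI)
    show "op_nonincreasing f"
      unfolding op_nonincreasing_iff f_def by (auto split: if_splits simp: mult_le_0_iff)
  next
    fix t v assume rel: "\<And>a b. b \<in> f a \<Longrightarrow> (a - t) * (b - v) \<le> 0"
    \<comment> \<open>Points of the horizontal ray give \<open>pos\<close>, points of the vertical
      ray give \<open>zero\<close>. Far out on the rays they force \<open>v \<ge> 0\<close> and
      \<open>t \<ge> 0\<close>, and the point at \<open>t / 2\<close> forces
      \<open>v \<le> 0\<close> if \<open>t > 0\<close>.\<close>
    have pos: "(a - t) * (0 - v) \<le> 0" if "a > 0" for a using rel[of 0 a] that by (simp add: f_def)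
    have zero: "(0 - t) * (b - v) \<le> 0" if "b \<ge> 0" for b using rel[of b 0] that by (simp add: f_def)
    have "t \<ge> 0"
      using zero[of "\<bar>v\<bar> + 1"] by (smt (verit) mult_pos_pos)
    moreover have "v \<ge> 0"
      using pos[of "\<bar>t\<bar> + 1"] by (smt (verit) mult_pos_pos)
    moreover have "v \<le> 0" if "t > 0"
      using pos[of "t / 2"] that by (simp add: mult_le_0_iff)
    ultimately show "v \<in> f t" by (auto simp: f_def order_le_less)
  qed
  then show ?thesis using True unfolding bound_op_def f_def by simp
next
  case False
  define \<tau> where "\<tau> s = m * s + c * s\<^sup>2" for s
  have iff: "v \<in> bound_op \<kappa> \<alpha> m c t \<longleftrightarrow> (\<exists>s\<ge>0. t = \<tau> s \<and> (\<exists>u\<in>\<alpha> s. v = \<kappa> * u))" for v t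
    unfolding \<tau>_def using bound_op_iff[OF dom m c] False by blast
  have dom': "u \<in> \<alpha> s \<Longrightarrow> s \<ge> 0" for u s using dom unfolding op_Dom_def by auto
  have less: "\<tau> r < \<tau> s" if "0 \<le> r" "r < s" for r s
  proof -
    have "m * r \<le> m * s" "c * r\<^sup>2 \<le> c * s\<^sup>2" using that m c
      by (auto intro!: mult_left_mono power_mono)
    moreover have "m * r < m * s \<or> c * r\<^sup>2 < c * s\<^sup>2"
      using False m c that by (auto simp: power_strict_mono order_le_less)
    ultimately show ?thesis unfolding \<tau>_def by linarith
  qed
  show ?thesis
  proof (rule M_downI)
    show "op_nonincreasing (bound_op \<kappa> \<alpha> m c)"
      unfolding op_nonincreasing_iff
    proof (intro allI ballI)
      fix x y u v assume "u \<in> bound_op \<kappa> \<alpha> m c x" "v \<in> bound_op \<kappa> \<alpha> m c y"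
      then obtain r u' s v' where *: "r \<ge> 0" "x = \<tau> r" "u' \<in> \<alpha> r" "u = \<kappa> * u'"
         "s \<ge> 0" "y = \<tau> s" "v' \<in> \<alpha> s" "v = \<kappa> * v'" unfolding iff by blast
      have le: "(s - r) * (v' - u') \<le> 0" using M_down_nonincreasing[OF \<alpha> *(3,7)] .
      have "(\<tau> s - \<tau> r) * (v' - u') \<le> 0"
        using le less[of r s] less[of s r] *(1,5)
        by (cases r s rule: linorder_cases) (auto simp: mult_le_0_iff)
      then have "\<kappa> * ((\<tau> s - \<tau> r) * (v' - u')) \<le> 0" using k by (simp add: mult_le_0_iff)
      then show "(y - x) * (v - u) \<le> 0" using * by (simp add: algebra_simps)
    qed
  next
    fix t v assume rel: "\<And>a b. b \<in> bound_op \<kappa> \<alpha> m c a \<Longrightarrow> (a - t) * (b - v) \<le> 0"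
    have rel': "(\<tau> s - t) * (u - v / \<kappa>) \<le> 0" if u: "u \<in> \<alpha> s" for s u
    proof -
      have "\<kappa> * u \<in> bound_op \<kappa> \<alpha> m c (\<tau> s)" unfolding iff using u dom'[OF u] by blast
      from rel[OF this] have "((\<tau> s - t) * (\<kappa> * u - v)) / \<kappa> \<le> 0" using k by (simp add: divide_le_0_iff)
      then show ?thesis using k by (simp add: field_simps)
    qed
    show "v \<in> bound_op \<kappa> \<alpha> m c t"
    proof (cases "t < 0")
      case True
      \<comment> \<open>A negative \<open>t\<close> is impossible: \<open>\<tau> s - t > 0\<close>
        on the whole domain, so \<open>(-1, v / \<kappa>)\<close> is related to the graph of
        \<open>\<alpha>\<close>, and maximality would put -1 into its domain.\<close>
      have "v / \<kappa> \<in> \<alpha> (-1)"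
      proof (rule M_down_complete[OF \<alpha>])
        fix s u assume u: "u \<in> \<alpha> s"
        have "\<tau> s \<ge> 0" "s \<ge> 0" using dom'[OF u] m c unfolding \<tau>_def by auto
        then show "(s - - 1) * (u - v / \<kappa>) \<le> 0" using rel'[OF u] True by (simp add: mult_le_0_iff)
      qed
      then show ?thesis using dom' by fastforce
    next
      case f: False
      have "\<exists>s\<ge>0. \<tau> s = t"
      proof -
        have "\<exists>b\<ge>0. t \<le> \<tau> b"
        proof (cases "m = 0")
          case True
          then have "c > 0" using False c by auto
          then have "\<tau> (sqrt (t / c)) = t" using True f by (simp add: \<tau>_def)
          then show ?thesis using f \<open>c > 0\<close> by (intro exI[of _ "sqrt (t / c)"]) auto
        next
          case nz: False
          then have "\<tau> (t / m) \<ge> t" using f c m by (simp add: \<tau>_def)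
          then show ?thesis using f m by (intro exI[of _ "t / m"]) auto
        qed
        then obtain b where b: "b \<ge> 0" "t \<le> \<tau> b" by blast
        have "\<exists>s\<ge>0. s \<le> b \<and> \<tau> s = t"
          by (rule IVT') (use b f in \<open>auto simp: \<tau>_def intro!: continuous_intros\<close>)
        then show ?thesis by blast
      qed
      then obtain s0 where s0: "s0 \<ge> 0" "\<tau> s0 = t" by blast
      have "v / \<kappa> \<in> \<alpha> s0"
      proof (rule M_down_complete[OF \<alpha>])
        fix s u assume u: "u \<in> \<alpha> s"
        show "(s - s0) * (u - v / \<kappa>) \<le> 0"
          using rel'[OF u] less[of s s0] less[of s0 s] s0 dom'[OF u]
          by (cases s s0 rule: linorder_cases) (auto simp: mult_le_0_iff)
      qed
      then show ?thesis unfolding iff using s0 k by (intro exI[of _ s0]) (auto intro!: bexI[of _ "v / \<kappa>"])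
    qed
  qed
qed

section \<open>Symmetric kernels on a finite index set\<close>

text \<open>Vectors are total functions of which only the values on \<open>I\<close> count. With
  \<open>I = {..<p} \<times> {..<n}\<close> this covers matrices of every size without a type for
  each dimension.\<close>

definition ip :: "'i set \<Rightarrow> ('i \<Rightarrow> real) \<Rightarrow> ('i \<Rightarrow> real) \<Rightarrow> real" where
  "ip I x y = (\<Sum>i\<in>I. x i * y i)"

definition kernel_app :: "'i set \<Rightarrow> ('i \<Rightarrow> 'i \<Rightarrow> real) \<Rightarrow> ('i \<Rightarrow> real) \<Rightarrow> 'i \<Rightarrow> real" where
  "kernel_app I l x i = (\<Sum>j\<in>I. l i j * x j)"

lemma ip_commute: "ip I x y = ip I y x"
  unfolding ip_def by (simp add: mult.commute)

lemma ip_add: "ip I x (\<lambda>i. y i + z i) = ip I x y + ip I x z"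
  unfolding ip_def by (simp add: sum.distrib algebra_simps)

lemma ip_diff: "ip I x (\<lambda>i. y i - z i) = ip I x y - ip I x z"
  unfolding ip_def by (simp add: sum_subtractf algebra_simps)

lemma ip_scale: "ip I x (\<lambda>i. c * y i) = c * ip I x y"
  unfolding ip_def by (simp add: sum_distrib_left algebra_simps)

lemma ip_sum: "ip I x (\<lambda>i. \<Sum>k\<in>S. y k i) = (\<Sum>k\<in>S. ip I x (y k))"
  unfolding ip_def sum_distrib_left by (rule sum.swap)

lemma ip_add_left: "ip I (\<lambda>i. y i + z i) x = ip I y x + ip I z x"
  using ip_add ip_commute by metis

lemma ip_diff_left: "ip I (\<lambda>i. y i - z i) x = ip I y x - ip I z x"
  using ip_diff ip_commute by metis

lemma ip_scale_left: "ip I (\<lambda>i. c * y i) x = c * ip I y x"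
  using ip_scale ip_commute by metis

lemma ip_sum_left: "ip I (\<lambda>i. \<Sum>k\<in>S. y k i) x = (\<Sum>k\<in>S. ip I (y k) x)"
  unfolding ip_commute[of I _ x] by (rule ip_sum)

lemma ip_cong: "(\<And>i. i \<in> I \<Longrightarrow> x i = x' i) \<Longrightarrow> (\<And>i. i \<in> I \<Longrightarrow> y i = y' i) \<Longrightarrow> ip I x y = ip I x' y'"
  unfolding ip_def by (rule sum.cong) auto

lemma ip_self: "ip I x x = (L2_set x I)\<^sup>2"
  unfolding ip_def L2_set_def by (simp add: sum_nonneg power2_eq_square)

lemma ip_self_nonneg: "ip I x x \<ge> 0"
  unfolding ip_self by simp

lemma ip_self_eq_0: "finite I \<Longrightarrow> ip I x x = 0 \<longleftrightarrow> (\<forall>i\<in>I. x i = 0)"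
  unfolding ip_self by (simp add: L2_set_eq_0_iff)

lemma ip_Cauchy_Schwarz: "\<bar>ip I x y\<bar> \<le> L2_set x I * L2_set y I"
proof -
  have "\<bar>ip I x y\<bar> \<le> (\<Sum>i\<in>I. \<bar>x i\<bar> * \<bar>y i\<bar>)"
    unfolding ip_def using sum_abs[of "\<lambda>i. x i * y i" I] by (simp add: abs_mult)
  then show ?thesis using L2_set_mult_ineq[of x y I] by linarith
qed

lemma kernel_app_ip: "kernel_app I l x i = ip I (l i) x"
  unfolding kernel_app_def ip_def ..

lemma ip_kernel_app_sym:
  assumes "\<And>i j. i \<in> I \<Longrightarrow> j \<in> I \<Longrightarrow> l i j = l j i"
  shows "ip I x (kernel_app I l y) = ip I (kernel_app I l x) y"
proof -
  have "ip I x (kernel_app I l y) = (\<Sum>i\<in>I. \<Sum>j\<in>I. x i * (l i j * y j))"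
    unfolding ip_def kernel_app_def by (simp add: sum_distrib_left)
  also have "\<dots> = (\<Sum>j\<in>I. \<Sum>i\<in>I. x i * (l i j * y j))" by (rule sum.swap)
  also have "\<dots> = (\<Sum>j\<in>I. \<Sum>i\<in>I. l j i * x i * y j)"
    by (intro sum.cong) (auto simp: assms)
  also have "\<dots> = ip I (kernel_app I l x) y"
    unfolding ip_def kernel_app_def by (simp add: sum_distrib_right)
  finally show ?thesis .
qed

section \<open>Orthonormal families\<close>

definition orthonormal_family :: "'i set \<Rightarrow> nat \<Rightarrow> (nat \<Rightarrow> 'i \<Rightarrow> real) \<Rightarrow> bool" where
  "orthonormal_family I r v \<longleftrightarrow> (\<forall>a<r. \<forall>b<r. ip I (v a) (v b) = (if a = b then 1 else 0))"

lemma ip_orthonormal_combination: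
  assumes "orthonormal_family I r v" "k < r"
  shows "ip I (v k) (\<lambda>i. \<Sum>a<r. c a * v a i) = c k"
proof -
  have "ip I (v k) (\<lambda>i. \<Sum>a<r. c a * v a i) = (\<Sum>a<r. c a * ip I (v k) (v a))"
    by (simp add: ip_sum ip_scale)
  also have "\<dots> = (\<Sum>a<r. if a = k then c a else 0)"
    using assms unfolding orthonormal_family_def by (intro sum.cong) auto
  finally show ?thesis using assms(2) by simp
qed

lemma ip_self_orthonormal_combination:
  assumes "orthonormal_family I r v"
  shows "ip I (\<lambda>i. \<Sum>a<r. c a * v a i) (\<lambda>i. \<Sum>a<r. c a * v a i) = (\<Sum>a<r. (c a)\<^sup>2)"
proof -
  have "ip I (\<lambda>i. \<Sum>a<r. c a * v a i) (\<lambda>i. \<Sum>a<r. c a * v a i)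
      = (\<Sum>a<r. c a * ip I (v a) (\<lambda>i. \<Sum>a<r. c a * v a i))"
    by (simp only: ip_sum_left ip_scale_left)
  then show ?thesis
    by (simp add: ip_orthonormal_combination[OF assms] power2_eq_square)
qed

lemma Bessel_inequality:
  assumes on: "orthonormal_family I r v"
  shows "(\<Sum>k<r. (ip I (v k) x)\<^sup>2) \<le> ip I x x"
proof -
  define c where "c k = ip I (v k) x" for k
  define s where "s i = (\<Sum>k<r. c k * v k i)" for i
  have xs: "ip I x s = (\<Sum>k<r. (c k)\<^sup>2)"
    unfolding s_def ip_commute[of I x] by (simp add: ip_sum_left ip_scale_left c_def power2_eq_square)
  have ss: "ip I s s = (\<Sum>k<r. (c k)\<^sup>2)"
    unfolding s_def by (rule ip_self_orthonormal_combination[OF on])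
  have "0 \<le> ip I (\<lambda>i. x i - s i) (\<lambda>i. x i - s i)" by (rule ip_self_nonneg)
  also have "\<dots> = ip I x x - 2 * ip I x s + ip I s s"
    using ip_commute[of I s x] by (simp add: ip_diff ip_diff_left)
  finally show ?thesis unfolding xs ss c_def by simp
qed

text \<open>Counts the squared entries of the family in two ways: by vectors they add up to
  \<open>r\<close>, and each coordinate contributes at most 1, by Bessel's inequality for the
  coordinate vector. This bounds the search for a largest family of eigenvectors.\<close>

lemma orthonormal_family_le_card:
  assumes fin: "finite I" and on: "orthonormal_family I r v"
  shows "r \<le> card I"
proof -
  have "real r = (\<Sum>k<r. ip I (v k) (v k))"
    using on unfolding orthonormal_family_def by simp
  also have "\<dots> = (\<Sum>i\<in>I. \<Sum>k<r. (v k i)\<^sup>2)"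
    unfolding ip_def power2_eq_square by (rule sum.swap)
  also have "\<dots> \<le> (\<Sum>i\<in>I. 1)"
  proof (rule sum_mono)
    fix i assume i: "i \<in> I"
    define e :: "'a \<Rightarrow> real" where "e j = (if j = i then 1 else 0)" for j
    have e: "ip I x e = x i" for x
    proof -
      have "ip I x e = (\<Sum>j\<in>I. if j = i then x j else 0)"
        unfolding ip_def e_def by (intro sum.cong) auto
      then show ?thesis using i fin by simp
    qed
    show "(\<Sum>k<r. (v k i)\<^sup>2) \<le> 1"
      using Bessel_inequality[OF on, of e] unfolding e by (simp add: e_def)
  qed
  finally show ?thesis by simp
qed

section \<open>The spectral theorem for symmetric kernels\<close>

lemma continuous_on_ip:
  fixes f g :: "'a::topological_space \<Rightarrow> 'i \<Rightarrow> real"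
  assumes "\<And>i. continuous_on S (\<lambda>x. f x i)" "\<And>i. continuous_on S (\<lambda>x. g x i)"
  shows "continuous_on S (\<lambda>x. ip I (f x) (g x))"
  unfolding ip_def by (intro continuous_on_sum continuous_on_mult assms)

text \<open>Maximizes the Rayleigh quotient on the unit sphere of \<open>W\<close>, the orthogonal
  complement of the eigenvectors found so far; \<open>z\<close> shows that \<open>W\<close> is
  nonzero. The maximizer is an eigenvector because the residual \<open>g\<close> of the eigenvalue
  equation is an admissible direction of perturbation.\<close>

lemma exists_eigenvector_orthogonal:
  fixes l :: "'i \<Rightarrow> 'i \<Rightarrow> real"
  assumes fin: "finite I" and sym: "\<And>i j. i \<in> I \<Longrightarrow> j \<in> I \<Longrightarrow> l i j = l j i"
    and eig: "\<And>k i. k < r \<Longrightarrow> i \<in> I \<Longrightarrow> kernel_app I l (v k) i = lam k * v k i"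
    and z: "\<And>k. k < r \<Longrightarrow> ip I (v k) z = 0" "ip I z z \<noteq> 0"
  obtains y \<mu> where "ip I y y = 1" "\<And>k. k < r \<Longrightarrow> ip I (v k) y = 0"
    "\<And>i. i \<in> I \<Longrightarrow> kernel_app I l y i = \<mu> * y i"
proof -
  define L where "L = kernel_app I l"
  define W where "W = {y :: 'i \<Rightarrow> real. \<forall>k<r. ip I (v k) y = 0}"
  \<comment> \<open>Vanishing off \<open>I\<close> makes the sphere compact in the product topology:
    it is a closed subset of a cube, which is compact by Tychonoff's theorem.\<close>
  define S where "S = {y \<in> W. (\<forall>i. i \<notin> I \<longrightarrow> y i = 0) \<and> ip I y y = 1}"
  have Lip: "ip I x (L y) = ip I (L x) y" for x y
    unfolding L_def by (rule ip_kernel_app_sym[OF sym])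
  have L_add: "L (\<lambda>i. x i + t * y i) = (\<lambda>i. L x i + t * L y i)" for x y t
    unfolding L_def kernel_app_ip by (simp add: ip_add ip_scale)
  have coord: "continuous_on A (\<lambda>y. y i :: real)" for i :: 'i and A
    by (rule continuous_on_subset[OF continuous_on_product_coordinates subset_UNIV])
  have unit: "\<exists>y\<in>S. \<exists>c>0. \<forall>i\<in>I. w i = c * y i" if w: "w \<in> W" "ip I w w \<noteq> 0" for w
  proof -
    define c where "c = sqrt (ip I w w)"
    have c: "c > 0" "c * c = ip I w w" unfolding c_def using w(2) ip_self_nonneg[of I w] by auto
    define y where "y i = (if i \<in> I then (1 / c) * w i else 0)" for i
    have ipy: "ip I x y = (1 / c) * ip I x w" for x
    proof -
      have "ip I x y = ip I x (\<lambda>i. (1 / c) * w i)" by (rule ip_cong) (auto simp: y_def)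
      then show ?thesis by (simp only: ip_scale)
    qed
    have "ip I y y = 1" using c unfolding ipy[of y] ip_commute[of I y w] ipy[of w]
      using w(2) by (simp add: field_simps)
    moreover have "ip I (v k) y = 0" if "k < r" for k using w(1) that unfolding ipy W_def by simp
    moreover have "y i = 0" if "i \<notin> I" for i using that by (simp add: y_def)
    ultimately have "y \<in> S" unfolding S_def W_def by blast
    moreover have "\<forall>i\<in>I. w i = c * y i" using c(1) by (simp add: y_def)
    ultimately show ?thesis using c(1) by blast
  qed
  have "compact S"
  proof -
    have box: "compact (PiE UNIV (\<lambda>_::'i. {-1..1::real}))"
      using compactin_PiE[of "\<lambda>_. euclidean" UNIV "\<lambda>_::'i. {-1..1::real}"]
      by (simp add: euclidean_product_topology)
    have "S = (\<Inter>k\<in>{..<r}. {y. ip I (v k) y = 0}) \<inter> (\<Inter>i\<in>-I. {y. y i = 0}) \<inter> {y. ip I y y = 1}"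
      unfolding S_def W_def by auto
    also have "closed \<dots>"
      by (intro closed_Int closed_INT ballI closed_Collect_eq continuous_on_ip coord continuous_on_const)
    finally have cl: "closed S" .
    have "S \<subseteq> PiE UNIV (\<lambda>_. {-1..1})"
    proof
      fix y assume y: "y \<in> S"
      have "\<bar>y i\<bar> \<le> 1" for i
      proof (cases "i \<in> I")
        case True
        have "(y i)\<^sup>2 \<le> (\<Sum>i\<in>I. (y i)\<^sup>2)" by (rule member_le_sum[OF True]) (auto simp: fin)
        then have "(y i)\<^sup>2 \<le> 1" using y unfolding S_def ip_def by (simp add: power2_eq_square)
        then show ?thesis by (simp add: abs_square_le_1)
      qed (use y in \<open>auto simp: S_def\<close>)
      then show "y \<in> PiE UNIV (\<lambda>_. {-1..1})" by (simp add: abs_le_iff PiE_iff minus_le_iff)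
    qed
    then show ?thesis using compact_Int_closed[OF box cl] by (simp add: Int_absorb1)
  qed
  moreover have "S \<noteq> {}" using unit[of z] z unfolding W_def by blast
  moreover have "continuous_on S (\<lambda>y. ip I y (L y))"
    unfolding L_def kernel_app_ip by (intro continuous_on_ip coord continuous_on_const)
  ultimately obtain y where y: "y \<in> S" and max: "\<And>w. w \<in> S \<Longrightarrow> ip I w (L w) \<le> ip I y (L y)"
    using continuous_attains_sup[of S "\<lambda>y. ip I y (L y)"] by blast
  define \<mu> where "\<mu> = ip I y (L y)"
  have yy: "ip I y y = 1" and yW: "y \<in> W" using y unfolding S_def by auto
  have Rayleigh: "ip I w (L w) \<le> \<mu> * ip I w w" if w: "w \<in> W" for w
  proof (cases "ip I w w = 0")
    case True
    then have "\<forall>i\<in>I. w i = 0" using ip_self_eq_0[OF fin] by blast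
    then have "ip I w (L w) = 0" unfolding ip_def by simp
    then show ?thesis using True by simp
  next
    case False
    then obtain u c where u: "u \<in> S" "c > 0" "\<forall>i\<in>I. w i = c * u i" using unit[OF w] by blast
    have Lw: "L w = (\<lambda>i. c * L u i)"
    proof
      fix i
      have "L w i = ip I (l i) (\<lambda>i. c * u i)"
        unfolding L_def kernel_app_ip by (rule ip_cong) (use u in auto)
      then show "L w i = c * L u i" unfolding L_def kernel_app_ip by (simp add: ip_scale)
    qed
    have w_eq: "ip I w x = c * ip I u x" for x
    proof -
      have "ip I w x = ip I (\<lambda>i. c * u i) x" by (rule ip_cong) (use u in auto)
      then show ?thesis by (simp only: ip_scale_left)
    qed
    have "ip I w (L w) = c * c * ip I u (L u)" unfolding Lw w_eq by (simp add: ip_scale)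
    also have "\<dots> \<le> c * c * \<mu>" unfolding \<mu>_def using max[OF u(1)] u(2) by (intro mult_left_mono) auto
    also have "c * c = ip I w w"
      using u(1) unfolding w_eq[of w] ip_commute[of I u w] w_eq[of u] by (simp add: S_def)
    finally show ?thesis by (simp add: mult.commute)
  qed
  define g where "g i = L y i - \<mu> * y i" for i
  have gW: "g \<in> W"
  proof -
    have "ip I (v k) g = 0" if k: "k < r" for k
    proof -
      have "ip I (v k) (L y) = ip I (\<lambda>i. lam k * v k i) y"
        unfolding Lip by (rule ip_cong) (use eig[OF k] in \<open>auto simp: L_def\<close>)
      then show ?thesis using yW k unfolding g_def W_def
        by (simp add: ip_diff ip_scale ip_scale_left)
    qed
    then show ?thesis unfolding W_def by blast
  qed
  define C where "C = \<mu> * ip I g g - ip I g (L g)"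
  have gg: "ip I g g = ip I g (L y) - \<mu> * ip I g y"
  proof -
    have "ip I g g = ip I g (\<lambda>i. L y i - \<mu> * y i)" by (rule ip_cong) (auto simp: g_def)
    then show ?thesis by (simp only: ip_diff ip_scale)
  qed
  \<comment> \<open>First-order condition at the maximum: the Rayleigh bound for
    \<open>y + t * g\<close> leaves the linear term \<open>2 * t * ip I g g\<close>, which
    \<open>t\<^sup>2 * C\<close> cannot dominate for small \<open>t > 0\<close> unless
    \<open>ip I g g = 0\<close>.\<close>
  have first_order: "2 * t * ip I g g \<le> t\<^sup>2 * C" for t
  proof -
    have "(\<lambda>i. y i + t * g i) \<in> W" using yW gW unfolding W_def by (simp add: ip_add ip_scale)
    from Rayleigh[OF this] have le: "ip I (\<lambda>i. y i + t * g i) (L (\<lambda>i. y i + t * g i))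
      \<le> \<mu> * ip I (\<lambda>i. y i + t * g i) (\<lambda>i. y i + t * g i)" .
    have exp: "ip I (\<lambda>i. y i + t * g i) (\<lambda>i. a i + t * b i)
      = ip I y a + t * ip I g a + t * ip I y b + t\<^sup>2 * ip I g b" for a b
      by (simp add: ip_add ip_scale ip_add_left ip_scale_left algebra_simps power2_eq_square)
    have "ip I y (L g) = ip I g (L y)" by (metis Lip ip_commute)
    then have "\<mu> + 2 * t * ip I g (L y) + t\<^sup>2 * ip I g (L g)
      \<le> \<mu> * (1 + 2 * t * ip I g y + t\<^sup>2 * ip I g g)"
      using le unfolding L_add exp yy ip_commute[of I y g] \<mu>_def[symmetric] by (simp add: algebra_simps)
    moreover have "2 * t * ip I g g = 2 * t * ip I g (L y) - \<mu> * (2 * t * ip I g y)"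
      by (subst gg) (simp add: algebra_simps)
    ultimately show ?thesis unfolding C_def by (simp add: algebra_simps)
  qed
  have "ip I g g = 0"
  proof (rule ccontr)
    assume "ip I g g \<noteq> 0"
    then have pos: "ip I g g > 0" using ip_self_nonneg[of I g] by linarith
    define t where "t = ip I g g / (\<bar>C\<bar> + 1)"
    have t: "t > 0" unfolding t_def using pos by (auto intro!: divide_pos_pos)
    have "t * (2 * ip I g g) \<le> t * (t * C)"
      using first_order[of t] by (simp add: power2_eq_square algebra_simps)
    then have "2 * ip I g g \<le> t * C" using t by simp
    also have "t * C \<le> t * (\<bar>C\<bar> + 1)" using t by (intro mult_left_mono) auto
    also have "\<dots> = ip I g g" unfolding t_def by simp
    finally show False using pos by simp
  qed
  then have "kernel_app I l y i = \<mu> * y i" if "i \<in> I" for i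
    using ip_self_eq_0[OF fin] that unfolding g_def L_def by auto
  then show ?thesis using that yy yW unfolding W_def by blast
qed

text \<open>A largest orthonormal family of eigenvectors spans: otherwise the component
  \<open>z\<close> of some \<open>x\<close> orthogonal to the family is nonzero, and
  \<open>exists_eigenvector_orthogonal\<close> enlarges the family.\<close>

theorem symmetric_kernel_spectral:
  fixes l :: "'i \<Rightarrow> 'i \<Rightarrow> real"
  assumes fin: "finite I" and sym: "\<And>i j. i \<in> I \<Longrightarrow> j \<in> I \<Longrightarrow> l i j = l j i"
  obtains r v lam where "orthonormal_family I r v"
    "\<And>x i. i \<in> I \<Longrightarrow> kernel_app I l x i = (\<Sum>k<r. lam k * ip I (v k) x * v k i)"
    "\<And>k i. k < r \<Longrightarrow> i \<in> I \<Longrightarrow> kernel_app I l (v k) i = lam k * v k i"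
proof -
  define P where "P r \<longleftrightarrow> (\<exists>v lam. orthonormal_family I r v \<and>
    (\<forall>k<r. \<forall>i\<in>I. kernel_app I l (v k) i = lam k * v k i))" for r
  have P0: "P 0" unfolding P_def orthonormal_family_def by auto
  have "P r \<Longrightarrow> r \<le> card I" for r
    using orthonormal_family_le_card[OF fin] unfolding P_def by blast
  then obtain r where r: "P r" and max: "\<And>r'. P r' \<Longrightarrow> r' \<le> r"
    using GreatestI_nat[of P 0 "card I"] Greatest_le_nat[of P _ "card I"] P0 by metis
  obtain v lam where on: "orthonormal_family I r v"
    and eig: "\<And>k i. k < r \<Longrightarrow> i \<in> I \<Longrightarrow> kernel_app I l (v k) i = lam k * v k i"
    using r unfolding P_def by blast
  have complete: "x i = (\<Sum>k<r. ip I (v k) x * v k i)" if i: "i \<in> I" for x i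
  proof (rule ccontr)
    assume ne: "x i \<noteq> (\<Sum>k<r. ip I (v k) x * v k i)"
    define z where "z i = x i - (\<Sum>k<r. ip I (v k) x * v k i)" for i
    have zv: "ip I (v k) z = 0" if "k < r" for k
      unfolding z_def ip_diff using ip_orthonormal_combination[OF on that] by simp
    have "z i \<noteq> 0" using ne unfolding z_def by simp
    then have "ip I z z \<noteq> 0" using ip_self_eq_0[OF fin] i by blast
    then obtain y \<mu> where y: "ip I y y = 1" "\<And>k. k < r \<Longrightarrow> ip I (v k) y = 0"
      "\<And>i. i \<in> I \<Longrightarrow> kernel_app I l y i = \<mu> * y i"
      using exists_eigenvector_orthogonal[of I l r v lam z thesis] fin sym eig zv by blast
    have "ip I y (v k) = 0" if "k < r" for k
      using y(2)[OF that] by (simp add: ip_commute[of I y "v k"])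
    then have "orthonormal_family I (Suc r) (v(r := y))"
      using on y(1,2) unfolding orthonormal_family_def by (auto simp: less_Suc_eq)
    moreover have "\<forall>k<Suc r. \<forall>i\<in>I. kernel_app I l ((v(r := y)) k) i = (lam(r := \<mu>)) k * (v(r := y)) k i"
      using eig y(3) by (auto simp: less_Suc_eq)
    ultimately have "P (Suc r)" unfolding P_def by blast
    from max[OF this] show False by simp
  qed
  have "kernel_app I l x i = (\<Sum>k<r. lam k * ip I (v k) x * v k i)" if i: "i \<in> I" for x i
  proof -
    have "kernel_app I l x i = ip I (l i) (\<lambda>j. \<Sum>k<r. ip I (v k) x * v k j)"
      unfolding kernel_app_ip by (rule ip_cong) (use complete in auto)
    also have "\<dots> = (\<Sum>k<r. ip I (v k) x * kernel_app I l (v k) i)"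
      unfolding kernel_app_ip by (simp add: ip_sum ip_scale)
    finally show ?thesis using eig i by (simp add: mult_ac)
  qed
  then show ?thesis using that on eig by blast
qed

text \<open>Passes to eigencoordinates, in which the convex parts of the form can be separated.
  Testing the assumed bound on a unit eigenvector gives
  \<open>\<bar>lam k\<bar> \<le> C\<close>.\<close>

lemma kernel_diagonalization:
  fixes l :: "'i \<Rightarrow> 'i \<Rightarrow> real"
  assumes fin: "finite I" and sym: "\<And>i j. i \<in> I \<Longrightarrow> j \<in> I \<Longrightarrow> l i j = l j i"
    and bound: "\<And>x. L2_set (kernel_app I l x) I \<le> C * L2_set x I"
  obtains r v lam where "orthonormal_family I r v"
    "\<And>x. ip I x (kernel_app I l x) = (\<Sum>k<r. lam k * (ip I (v k) x)\<^sup>2)"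
    "\<And>x. L2_set (kernel_app I l x) I = L2_set (\<lambda>k. lam k * ip I (v k) x) {..<r}"
    "\<And>k. k < r \<Longrightarrow> \<bar>lam k\<bar> \<le> C"
proof -
  obtain r v lam where on: "orthonormal_family I r v"
    and sp: "\<And>x i. i \<in> I \<Longrightarrow> kernel_app I l x i = (\<Sum>k<r. lam k * ip I (v k) x * v k i)"
    and eig: "\<And>k i. k < r \<Longrightarrow> i \<in> I \<Longrightarrow> kernel_app I l (v k) i = lam k * v k i"
    using symmetric_kernel_spectral[of I l thesis] fin sym by blast
  have "ip I x (kernel_app I l x) = (\<Sum>k<r. lam k * (ip I (v k) x)\<^sup>2)" for x
  proof -
    have "ip I x (kernel_app I l x) = ip I x (\<lambda>i. \<Sum>k<r. (lam k * ip I (v k) x) * v k i)"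
      by (rule ip_cong) (use sp in auto)
    then show ?thesis
      unfolding ip_commute[of I x] by (simp add: ip_sum_left ip_scale_left power2_eq_square mult.assoc)
  qed
  moreover have "L2_set (kernel_app I l x) I = L2_set (\<lambda>k. lam k * ip I (v k) x) {..<r}" for x
  proof -
    have "(L2_set (kernel_app I l x) I)\<^sup>2 = ip I (\<lambda>i. \<Sum>k<r. (lam k * ip I (v k) x) * v k i)
        (\<lambda>i. \<Sum>k<r. (lam k * ip I (v k) x) * v k i)"
      unfolding ip_self[symmetric] by (rule ip_cong) (use sp in auto)
    also have "\<dots> = (L2_set (\<lambda>k. lam k * ip I (v k) x) {..<r})\<^sup>2"
      unfolding ip_self_orthonormal_combination[OF on] by (simp add: L2_set_def sum_nonneg)
    finally show ?thesis by (simp add: power2_eq_iff_nonneg)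
  qed
  moreover have "\<bar>lam k\<bar> \<le> C" if k: "k < r" for k
  proof -
    have "(L2_set (v k) I)\<^sup>2 = 1"
      using on k unfolding ip_self[symmetric] orthonormal_family_def by simp
    then have one: "L2_set (v k) I = 1"
      by (metis L2_set_nonneg one_power2 power2_eq_iff_nonneg zero_le_one)
    have "L2_set (kernel_app I l (v k)) I = L2_set (\<lambda>i. lam k * v k i) I"
      by (rule L2_set_cong) (use eig[OF k] in auto)
    also have "\<dots> = L2_set (\<lambda>i. \<bar>lam k\<bar> * v k i) I"
      unfolding L2_set_def by (simp add: power_mult_distrib)
    also have "\<dots> = \<bar>lam k\<bar> * L2_set (v k) I" by (simp add: L2_set_right_distrib)
    finally show ?thesis using bound[of "v k"] one by simp
  qed
  ultimately show ?thesis using that on by blast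
qed

section \<open>Quadratic forms in diagonal form\<close>

definition dst :: "'i set \<Rightarrow> ('i \<Rightarrow> real) \<Rightarrow> ('i \<Rightarrow> real) \<Rightarrow> real" where
  "dst I x y = L2_set (\<lambda>i. x i - y i) I"

text \<open>The factor 1/2 makes \<open>\<Sum>k<r. lam k * ip I (v k) x * v k i\<close> the
  gradient, whose norm is \<open>grad_norm\<close> when \<open>v\<close> is orthonormal.\<close>

definition quad_form :: "'i set \<Rightarrow> nat \<Rightarrow> (nat \<Rightarrow> 'i \<Rightarrow> real) \<Rightarrow> (nat \<Rightarrow> real) \<Rightarrow> ('i \<Rightarrow> real) \<Rightarrow> real" where
  "quad_form I r v lam x = (\<Sum>k<r. lam k * (ip I (v k) x)\<^sup>2) / 2"

definition grad_norm :: "'i set \<Rightarrow> nat \<Rightarrow> (nat \<Rightarrow> 'i \<Rightarrow> real) \<Rightarrow> (nat \<Rightarrow> real) \<Rightarrow> ('i \<Rightarrow> real) \<Rightarrow> real" where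
  "grad_norm I r v lam x = L2_set (\<lambda>k. lam k * ip I (v k) x) {..<r}"

text \<open>Exchanging \<open>x\<close> and \<open>y\<close> gives the two-sided bound. Since
  \<open>dst\<close> sees only the coordinates in \<open>I\<close>, such an \<open>f\<close> depends
  only on them.\<close>

definition lipschitz1 :: "'i set \<Rightarrow> (('i \<Rightarrow> real) \<Rightarrow> real) \<Rightarrow> bool" where
  "lipschitz1 I f \<longleftrightarrow> (\<forall>x y. f x - f y \<le> dst I x y)"

definition convex_fun :: "(('i \<Rightarrow> real) \<Rightarrow> real) \<Rightarrow> bool" where
  "convex_fun f \<longleftrightarrow> (\<forall>x y u v. u \<ge> 0 \<longrightarrow> v \<ge> 0 \<longrightarrow> u + v = 1 \<longrightarrow>
     f (\<lambda>i. u * x i + v * y i) \<le> u * f x + v * f y)"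

definition set_dist :: "'i set \<Rightarrow> ('i \<Rightarrow> real) set \<Rightarrow> ('i \<Rightarrow> real) \<Rightarrow> real" where
  "set_dist I S x = (INF y\<in>S. dst I x y)"

lemma dst_nonneg [simp]: "dst I x y \<ge> 0"
  unfolding dst_def by simp

lemma dst_refl [simp]: "dst I x x = 0"
  unfolding dst_def by (simp add: L2_set_def)

lemma dst_commute: "dst I x y = dst I y x"
  unfolding dst_def L2_set_def by (simp add: power2_commute)

lemma dst_triangle: "dst I x z \<le> dst I x y + dst I y z"
  unfolding dst_def using L2_set_triangle_ineq[of "\<lambda>i. x i - y i" "\<lambda>i. y i - z i" I] by simp

lemma L2_set_abs_scale: "L2_set (\<lambda>i. c * f i) A = \<bar>c\<bar> * L2_set f A"
proof -
  have "L2_set (\<lambda>i. c * f i) A = L2_set (\<lambda>i. \<bar>c\<bar> * f i) A"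
    unfolding L2_set_def by (simp add: power_mult_distrib)
  then show ?thesis by (simp add: L2_set_right_distrib)
qed

lemma dst_segment:
  assumes "0 \<le> t" "t \<le> 1"
  shows "dst I x (\<lambda>i. y i + t * (x i - y i)) = (1 - t) * dst I x y"
    "dst I (\<lambda>i. y i + t * (x i - y i)) y = t * dst I x y"
proof -
  have "dst I x (\<lambda>i. y i + t * (x i - y i)) = L2_set (\<lambda>i. (1 - t) * (x i - y i)) I"
    unfolding dst_def by (rule L2_set_cong) (auto simp: algebra_simps)
  then show "dst I x (\<lambda>i. y i + t * (x i - y i)) = (1 - t) * dst I x y"
    using assms unfolding L2_set_abs_scale dst_def by simp
  show "dst I (\<lambda>i. y i + t * (x i - y i)) y = t * dst I x y"
    using assms L2_set_abs_scale[of t "\<lambda>i. x i - y i" I] unfolding dst_def by simp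
qed

lemma dst_convex:
  assumes "u \<ge> 0" "v \<ge> 0"
  shows "dst I (\<lambda>i. u * x i + v * y i) (\<lambda>i. u * x' i + v * y' i) \<le> u * dst I x x' + v * dst I y y'"
proof -
  have "dst I (\<lambda>i. u * x i + v * y i) (\<lambda>i. u * x' i + v * y' i)
    = L2_set (\<lambda>i. u * (x i - x' i) + v * (y i - y' i)) I"
    unfolding dst_def by (rule L2_set_cong) (auto simp: algebra_simps)
  also have "\<dots> \<le> L2_set (\<lambda>i. u * (x i - x' i)) I + L2_set (\<lambda>i. v * (y i - y' i)) I"
    by (rule L2_set_triangle_ineq)
  finally show ?thesis unfolding L2_set_abs_scale dst_def using assms by simp
qed

lemma set_dist_le: "y \<in> S \<Longrightarrow> set_dist I S x \<le> dst I x y"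
  unfolding set_dist_def by (rule cINF_lower) (auto intro: bdd_belowI[of _ 0])

lemma set_dist_nonneg: "S \<noteq> {} \<Longrightarrow> set_dist I S x \<ge> 0"
  unfolding set_dist_def by (rule cINF_greatest) auto

lemma set_dist_eq_0: "x \<in> S \<Longrightarrow> set_dist I S x = 0"
  using set_dist_le[of x S I x] set_dist_nonneg[of S I x] by fastforce

lemma set_dist_lessD: "S \<noteq> {} \<Longrightarrow> set_dist I S x < e \<Longrightarrow> \<exists>y\<in>S. dst I x y < e"
  unfolding set_dist_def by (subst (asm) cINF_less_iff) (auto intro: bdd_belowI[of _ 0])

lemma set_dist_geI: "S \<noteq> {} \<Longrightarrow> (\<And>y. y \<in> S \<Longrightarrow> d \<le> dst I x y) \<Longrightarrow> d \<le> set_dist I S x"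
  unfolding set_dist_def by (rule cINF_greatest)

lemma set_dist_lipschitz:
  assumes "S \<noteq> {}"
  shows "lipschitz1 I (set_dist I S)"
  unfolding lipschitz1_def
proof (intro allI)
  fix x z
  have "set_dist I S x - dst I x z \<le> set_dist I S z"
  proof (rule set_dist_geI[OF assms])
    fix y assume "y \<in> S"
    then show "set_dist I S x - dst I x z \<le> dst I z y"
      using set_dist_le[of y S I x] dst_triangle[of I x y z] by linarith
  qed
  then show "set_dist I S x - set_dist I S z \<le> dst I x z" by simp
qed

text \<open>Convex combinations of almost nearest points stay in \<open>S\<close>; the slack
  \<open>e\<close> stands in for attained infima.\<close>

lemma set_dist_convex:
  assumes S: "S \<noteq> {}" and conv: "\<And>x y u v. x \<in> S \<Longrightarrow> y \<in> S \<Longrightarrow> u \<ge> 0 \<Longrightarrow> v \<ge> 0 \<Longrightarrow> u + v = 1 \<Longrightarrow>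
      (\<lambda>i. u * x i + v * y i) \<in> S"
  shows "convex_fun (set_dist I S)"
  unfolding convex_fun_def
proof (intro allI impI)
  fix x y :: "'a \<Rightarrow> real" and u v :: real assume uv: "u \<ge> 0" "v \<ge> 0" "u + v = 1"
  show "set_dist I S (\<lambda>i. u * x i + v * y i) \<le> u * set_dist I S x + v * set_dist I S y"
  proof (rule field_le_epsilon)
    fix e :: real assume e: "e > 0"
    obtain x' where x': "x' \<in> S" "dst I x x' < set_dist I S x + e"
      using set_dist_lessD[OF S, of I x "set_dist I S x + e"] e by auto
    obtain y' where y': "y' \<in> S" "dst I y y' < set_dist I S y + e"
      using set_dist_lessD[OF S, of I y "set_dist I S y + e"] e by auto
    have "set_dist I S (\<lambda>i. u * x i + v * y i)
      \<le> dst I (\<lambda>i. u * x i + v * y i) (\<lambda>i. u * x' i + v * y' i)"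
      by (rule set_dist_le) (rule conv[OF x'(1) y'(1) uv])
    also have "\<dots> \<le> u * dst I x x' + v * dst I y y'" by (rule dst_convex[OF uv(1,2)])
    also have "\<dots> \<le> u * (set_dist I S x + e) + v * (set_dist I S y + e)"
      using x' y' uv by (intro add_mono mult_left_mono) auto
    also have "\<dots> = u * set_dist I S x + v * set_dist I S y + (u + v) * e"
      by (simp add: algebra_simps)
    finally show "set_dist I S (\<lambda>i. u * x i + v * y i) \<le> u * set_dist I S x + v * set_dist I S y + e"
      using uv by simp
  qed
qed

lemma grad_norm_nonneg [simp]: "grad_norm I r v lam x \<ge> 0"
  unfolding grad_norm_def by simp

lemma grad_norm_mono:
  assumes "\<And>k. k < r \<Longrightarrow> \<bar>lam' k\<bar> \<le> \<bar>lam k\<bar>"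
  shows "grad_norm I r v lam' x \<le> grad_norm I r v lam x"
  unfolding grad_norm_def L2_set_def
  using assms by (intro real_sqrt_le_mono sum_mono) (auto simp: abs_le_square_iff[symmetric] abs_mult intro!: mult_right_mono)

lemma grad_norm_convex: "convex_fun (grad_norm I r v lam)"
  unfolding convex_fun_def
proof (intro allI impI)
  fix x y :: "'a \<Rightarrow> real" and a b :: real assume uv: "a \<ge> 0" "b \<ge> 0" "a + b = 1"
  have "grad_norm I r v lam (\<lambda>i. a * x i + b * y i)
    = L2_set (\<lambda>k. a * (lam k * ip I (v k) x) + b * (lam k * ip I (v k) y)) {..<r}"
    unfolding grad_norm_def by (rule L2_set_cong) (auto simp: ip_add ip_scale algebra_simps)
  also have "\<dots> \<le> L2_set (\<lambda>k. a * (lam k * ip I (v k) x)) {..<r} + L2_set (\<lambda>k. b * (lam k * ip I (v k) y)) {..<r}"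
    by (rule L2_set_triangle_ineq)
  also have "\<dots> = a * grad_norm I r v lam x + b * grad_norm I r v lam y"
    unfolding L2_set_abs_scale grad_norm_def using uv by simp
  finally show "grad_norm I r v lam (\<lambda>i. a * x i + b * y i) \<le> a * grad_norm I r v lam x + b * grad_norm I r v lam y" .
qed

lemma coefficients_le_dst:
  assumes "orthonormal_family I r v"
  shows "L2_set (\<lambda>k. ip I (v k) x - ip I (v k) y) {..<r} \<le> dst I x y"
proof -
  have "(\<Sum>k<r. (ip I (v k) (\<lambda>i. x i - y i))\<^sup>2) \<le> (dst I x y)\<^sup>2"
    using Bessel_inequality[OF assms, of "\<lambda>i. x i - y i"] unfolding ip_self dst_def .
  then show ?thesis unfolding L2_set_def ip_diff
    by (intro real_le_lsqrt) (auto intro: sum_nonneg)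
qed

text \<open>The vector of eigencoordinates is 1-Lipschitz by Bessel's inequality, and the factors
  \<open>lam k\<close> stretch by at most \<open>2 * K\<close>. Hence the normalization
  \<open>\<psi> / (2 * K)\<close> of the test function.\<close>

lemma grad_norm_lipschitz:
  assumes on: "orthonormal_family I r v" and lam: "\<And>k. k < r \<Longrightarrow> \<bar>lam k\<bar> \<le> 2 * K" and K: "K \<ge> 0"
  shows "grad_norm I r v lam x - grad_norm I r v lam y \<le> 2 * K * dst I x y"
proof -
  let ?d = "\<lambda>k. ip I (v k) x - ip I (v k) y"
  have "grad_norm I r v lam x = L2_set (\<lambda>k. lam k * ?d k + lam k * ip I (v k) y) {..<r}"
    unfolding grad_norm_def by (rule L2_set_cong) (auto simp: algebra_simps)
  also have "\<dots> \<le> L2_set (\<lambda>k. lam k * ?d k) {..<r} + grad_norm I r v lam y"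
    unfolding grad_norm_def by (rule L2_set_triangle_ineq)
  also have "L2_set (\<lambda>k. lam k * ?d k) {..<r} \<le> L2_set (\<lambda>k. (2 * K) * ?d k) {..<r}"
    unfolding L2_set_def using lam K
    by (intro real_sqrt_le_mono sum_mono) (auto simp: abs_le_square_iff[symmetric] abs_mult intro!: mult_right_mono)
  also have "\<dots> \<le> 2 * K * dst I x y"
    unfolding L2_set_abs_scale using coefficients_le_dst[OF on] K by (simp add: mult_left_mono)
  finally show ?thesis by simp
qed

text \<open>Taylor expansion at \<open>y\<close>, exact because the form is quadratic: the gradient
  against the displacement plus half of the Hessian term.\<close>

lemma quad_form_expand:
  "quad_form I r v lam x - quad_form I r v lam y =
    ip {..<r} (\<lambda>k. lam k * ip I (v k) y) (\<lambda>k. ip I (v k) x - ip I (v k) y)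
    + (\<Sum>k<r. lam k * (ip I (v k) x - ip I (v k) y)\<^sup>2) / 2"
proof -
  have "(\<Sum>k<r. lam k * (ip I (v k) x)\<^sup>2) - (\<Sum>k<r. lam k * (ip I (v k) y)\<^sup>2)
    = (\<Sum>k<r. 2 * (lam k * ip I (v k) y * (ip I (v k) x - ip I (v k) y))
       + lam k * (ip I (v k) x - ip I (v k) y)\<^sup>2)"
    unfolding sum_subtractf[symmetric]
    by (rule sum.cong) (auto simp: algebra_simps power2_eq_square)
  also have "\<dots> = 2 * ip {..<r} (\<lambda>k. lam k * ip I (v k) y) (\<lambda>k. ip I (v k) x - ip I (v k) y)
    + (\<Sum>k<r. lam k * (ip I (v k) x - ip I (v k) y)\<^sup>2)"
    unfolding sum.distrib ip_def[of "{..<r}"] by (simp add: sum_distrib_left)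
  finally show ?thesis unfolding quad_form_def by argo
qed

lemma quad_form_first_order:
  assumes on: "orthonormal_family I r v"
  shows "\<bar>ip {..<r} (\<lambda>k. lam k * ip I (v k) y) (\<lambda>k. ip I (v k) x - ip I (v k) y)\<bar>
    \<le> grad_norm I r v lam y * dst I x y"
proof -
  have "\<bar>ip {..<r} (\<lambda>k. lam k * ip I (v k) y) (\<lambda>k. ip I (v k) x - ip I (v k) y)\<bar>
    \<le> grad_norm I r v lam y * L2_set (\<lambda>k. ip I (v k) x - ip I (v k) y) {..<r}"
    unfolding grad_norm_def by (rule ip_Cauchy_Schwarz)
  also have "\<dots> \<le> grad_norm I r v lam y * dst I x y"
    by (intro mult_left_mono coefficients_le_dst[OF on] grad_norm_nonneg)
  finally show ?thesis .
qed

text \<open>Half of the eigenvalue bound \<open>2 * K\<close> is the constant \<open>K\<close> of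
  the quadratic remainder.\<close>

lemma quad_form_diff_le:
  assumes on: "orthonormal_family I r v" and lam: "\<And>k. k < r \<Longrightarrow> \<bar>lam k\<bar> \<le> 2 * K" and K: "K \<ge> 0"
  shows "\<bar>quad_form I r v lam x - quad_form I r v lam y\<bar>
    \<le> grad_norm I r v lam y * dst I x y + K * (dst I x y)\<^sup>2"
proof -
  let ?d = "\<lambda>k. ip I (v k) x - ip I (v k) y"
  have "\<bar>\<Sum>k<r. lam k * (?d k)\<^sup>2\<bar> \<le> (\<Sum>k<r. 2 * K * (?d k)\<^sup>2)"
    using lam by (intro order_trans[OF sum_abs] sum_mono) (auto simp: abs_mult intro!: mult_right_mono)
  also have "\<dots> = 2 * K * (L2_set ?d {..<r})\<^sup>2"
    by (simp add: L2_set_def sum_nonneg sum_distrib_left)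
  also have "\<dots> \<le> 2 * K * (dst I x y)\<^sup>2"
    using K coefficients_le_dst[OF on] by (intro mult_left_mono power_mono) auto
  finally show ?thesis
    using quad_form_first_order[OF on, of lam y x] quad_form_expand[of I r v lam x y] by argo
qed

text \<open>By convexity the tangent at \<open>x\<close> lies below the form, so no quadratic
  remainder appears when the gradient is taken at \<open>x\<close>.\<close>

lemma quad_form_convex_diff_le:
  assumes on: "orthonormal_family I r v" and lam: "\<And>k. k < r \<Longrightarrow> lam k \<ge> 0"
  shows "quad_form I r v lam x - quad_form I r v lam y \<le> grad_norm I r v lam x * dst I x y"
proof -
  have "(\<Sum>k<r. lam k * (ip I (v k) y - ip I (v k) x)\<^sup>2) \<ge> 0"
    using lam by (intro sum_nonneg) auto
  then show ?thesis
    using quad_form_first_order[OF on, of lam x y] quad_form_expand[of I r v lam y x]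
    unfolding dst_commute[of I x y] by argo
qed

lemma quad_form_convex:
  assumes lam: "\<And>k. k < r \<Longrightarrow> lam k \<ge> 0"
  shows "convex_fun (quad_form I r v lam)"
  unfolding convex_fun_def
proof (intro allI impI)
  fix x y :: "'a \<Rightarrow> real" and a b :: real assume uv: "a \<ge> 0" "b \<ge> 0" "a + b = 1"
  have sq: "(a * s + b * t)\<^sup>2 \<le> a * s\<^sup>2 + b * t\<^sup>2" for s t :: real
  proof -
    have "a * s\<^sup>2 + b * t\<^sup>2 - (a * s + b * t)\<^sup>2 = a * b * (s - t)\<^sup>2"
    proof -
      have b: "b = 1 - a" using uv by simp
      show ?thesis unfolding b by (simp add: algebra_simps power2_eq_square)
    qed
    moreover have "\<dots> \<ge> 0" using uv by simp
    ultimately show ?thesis by linarith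
  qed
  have "(\<Sum>k<r. lam k * (a * ip I (v k) x + b * ip I (v k) y)\<^sup>2)
    \<le> (\<Sum>k<r. lam k * (a * (ip I (v k) x)\<^sup>2 + b * (ip I (v k) y)\<^sup>2))"
    using lam sq by (intro sum_mono mult_left_mono) auto
  also have "\<dots> = a * (\<Sum>k<r. lam k * (ip I (v k) x)\<^sup>2) + b * (\<Sum>k<r. lam k * (ip I (v k) y)\<^sup>2)"
    unfolding sum_distrib_left sum.distrib[symmetric] by (rule sum.cong) (auto simp: algebra_simps)
  finally show "quad_form I r v lam (\<lambda>i. a * x i + b * y i)
    \<le> a * quad_form I r v lam x + b * quad_form I r v lam y"
    unfolding quad_form_def ip_add ip_scale by argo
qed

section \<open>Medians and measurability\<close>

lemma (in prob_space) is_median_iff_surv: "is_median M Y m \<longleftrightarrow> 1 / 2 \<in> surv M Y m"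
  if [measurable]: "Y \<in> borel_measurable M"
proof -
  have "prob {w \<in> space M. \<not> Y w \<le> m} = 1 - prob {w \<in> space M. Y w \<le> m}"
    by (rule prob_neg) measurable
  then have "prob {w \<in> space M. Y w > m} = 1 - prob {w \<in> space M. Y w \<le> m}"
    by (simp add: not_le)
  then show ?thesis unfolding is_median_def surv_def by auto
qed

text \<open>Medians are the points where \<open>surv\<close> takes the value 1/2, and by maximality
  it is enough that \<open>(m, 1 / 2)\<close> is related to the graph. The supremum \<open>m\<close>
  of all \<open>a\<close> with tail at least 1/2 has this property; the two limits show that
  \<open>S\<close> is nonempty and bounded above.\<close>

lemma (in prob_space) median_exists:
  assumes Y[measurable]: "Y \<in> borel_measurable M"
  shows "\<exists>m. is_median M Y m"
proof -
  define S where "S = {a. prob {w \<in> space M. Y w \<ge> a} \<ge> 1 / 2}"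
  have "(\<lambda>k. prob {w \<in> space M. Y w \<ge> - real k}) \<longlonglongrightarrow> prob (\<Union>k. {w \<in> space M. Y w \<ge> - real k})"
    by (rule finite_Lim_measure_incseq) (auto simp: incseq_def)
  also have "(\<Union>k. {w \<in> space M. Y w \<ge> - real k}) = space M"
  proof -
    have "\<exists>k. y \<ge> - real k" for y :: real using real_arch_simple[of "- y"] by (auto simp: minus_le_iff)
    then show ?thesis by auto
  qed
  finally have lim1: "(\<lambda>k. prob {w \<in> space M. Y w \<ge> - real k}) \<longlonglongrightarrow> 1" by (simp add: prob_space)
  have "(\<lambda>k. prob {w \<in> space M. Y w \<ge> real k}) \<longlonglongrightarrow> prob (\<Inter>k. {w \<in> space M. Y w \<ge> real k})"
    by (rule finite_Lim_measure_decseq) (auto simp: decseq_def intro: order_trans[rotated])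
  also have "(\<Inter>k. {w \<in> space M. Y w \<ge> real k}) = {}"
  proof -
    have "\<exists>k. \<not> y \<ge> real k" for y :: real using reals_Archimedean2[of y] by (auto simp: not_le)
    then show ?thesis by auto
  qed
  finally have lim0: "(\<lambda>k. prob {w \<in> space M. Y w \<ge> real k}) \<longlonglongrightarrow> 0" by simp
  obtain k1 where "prob {w \<in> space M. Y w \<ge> - real k1} > 1 / 2"
    using order_tendstoD(1)[OF lim1, of "1 / 2"] by (auto simp: eventually_sequentially)
  then have ne: "S \<noteq> {}" unfolding S_def by (auto intro!: exI[of _ "- real k1"])
  obtain k0 where k0: "prob {w \<in> space M. Y w \<ge> real k0} < 1 / 2"
    using order_tendstoD(2)[OF lim0, of "1 / 2"] by (auto simp: eventually_sequentially)
  have anti: "prob {w \<in> space M. Y w \<ge> b} \<le> prob {w \<in> space M. Y w \<ge> a}" if "a \<le> b" for a b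
    using that by (intro finite_measure_mono) auto
  have bdd: "bdd_above S"
  proof (rule bdd_aboveI[of _ "real k0"])
    fix a assume "a \<in> S"
    then show "a \<le> real k0" using anti[of "real k0" a] k0 unfolding S_def by force
  qed
  define m where "m = Sup S"
  have "1 / 2 \<in> surv M Y m"
  proof (rule M_down_complete[OF surv_M_down[OF Y]])
    fix a b assume b: "b \<in> surv M Y a"
    consider "a < m" | "a = m" | "a > m" by linarith
    then show "(a - m) * (b - 1 / 2) \<le> 0"
    proof cases
      case 1
      then obtain a' where a': "a' \<in> S" "a < a'" unfolding m_def using less_cSup_iff[OF ne bdd] by blast
      have "prob {w \<in> space M. Y w \<ge> a'} \<le> prob {w \<in> space M. Y w > a}"
        using a' by (intro finite_measure_mono) auto
      then have "b \<ge> 1 / 2" using a' b unfolding S_def surv_def by auto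
      then show ?thesis using 1 by (simp add: mult_le_0_iff)
    next
      case 3
      then have "a \<notin> S" unfolding m_def using cSup_upper[OF _ bdd, of a] by force
      then have "b \<le> 1 / 2" using b unfolding S_def surv_def by auto
      then show ?thesis using 3 by (simp add: mult_le_0_iff)
    qed simp
  qed
  then show ?thesis using is_median_iff_surv[OF Y] by blast
qed

text \<open>A median below \<open>d\<close> makes \<open>d\<close> itself a median.\<close>

lemma (in prob_space) median_exists_ge:
  assumes Y[measurable]: "Y \<in> borel_measurable M" and d: "prob {w \<in> space M. Y w \<ge> d} \<ge> 1 / 2"
  shows "\<exists>m\<ge>d. is_median M Y m"
proof -
  obtain m where m: "is_median M Y m" using median_exists[OF Y] by blast
  show ?thesis
  proof (cases "m \<ge> d")
    case False
    then have "prob {w \<in> space M. Y w \<le> m} \<le> prob {w \<in> space M. Y w \<le> d}"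
      by (intro finite_measure_mono) auto
    then have "is_median M Y d" using m d unfolding is_median_def by linarith
    then show ?thesis by blast
  qed (use m in blast)
qed

lemma is_median_scale:
  assumes "c > 0"
  shows "is_median M (\<lambda>w. c * Y w) m \<longleftrightarrow> is_median M Y (m / c)"
  using assms unfolding is_median_def by (simp add: field_simps)

text \<open>A 1-Lipschitz function is continuous for the product topology because \<open>dst\<close>
  involves finitely many coordinates. \<open>Z\<close> replaces the coordinates off
  \<open>I\<close>, whose measurability is not assumed, without changing the value of
  \<open>f\<close>.\<close>

lemma lipschitz1_measurable:
  fixes Y :: "'w \<Rightarrow> 'i :: countable \<Rightarrow> real"
  assumes fin: "finite I" and Y: "\<And>i. i \<in> I \<Longrightarrow> (\<lambda>w. Y w i) \<in> borel_measurable M" and f: "lipschitz1 I f"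
  shows "(\<lambda>w. f (Y w)) \<in> borel_measurable M"
proof -
  define Z where "Z w i = (if i \<in> I then Y w i else 0)" for w i
  have close: "\<bar>f x - f y\<bar> \<le> dst I x y" for x y
    using f dst_commute[of I x y] unfolding lipschitz1_def by (smt (verit))
  have fZ: "f (Y w) = f (Z w)" for w
  proof -
    have "dst I (Y w) (Z w) = 0" unfolding dst_def Z_def by (rule L2_set_0') auto
    then show ?thesis using close[of "Y w" "Z w"] by simp
  qed
  have "(\<lambda>w. Z w i) \<in> borel_measurable M" for i
    by (cases "i \<in> I") (auto simp: Z_def intro: Y)
  then have Z: "Z \<in> borel_measurable M" by (rule measurable_coordinatewise_then_product)
  have "isCont f x" for x
  proof -
    have "((\<lambda>y. sqrt (\<Sum>i\<in>I. (y i - x i)\<^sup>2)) \<longlongrightarrow> sqrt (\<Sum>i\<in>I. (x i - x i)\<^sup>2)) (at x)"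
      by (intro tendsto_intros tendsto_sum)
        (metis UNIV_I continuous_on_product_coordinates continuous_on)
    then have "((\<lambda>y. dst I y x) \<longlongrightarrow> 0) (at x)" unfolding dst_def L2_set_def by simp
    then have "((\<lambda>y. f y - f x) \<longlongrightarrow> 0) (at x)"
      by (rule Lim_null_comparison[rotated]) (use close in auto)
    then show ?thesis unfolding isCont_def by (rule LIM_zero_cancel)
  qed
  then have "f \<in> borel_measurable borel"
    by (intro borel_measurable_continuous_onI) (simp add: continuous_at_imp_continuous_on)
  then have "(\<lambda>w. f (Z w)) \<in> borel_measurable M" using Z by measurable
  then show ?thesis unfolding fZ .
qed

lemma quad_form_measurable:
  assumes "\<And>i. i \<in> I \<Longrightarrow> (\<lambda>w. Y w i) \<in> borel_measurable M"
  shows "(\<lambda>w. quad_form I r v lam (Y w)) \<in> borel_measurable M"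
    "(\<lambda>w. grad_norm I r v lam (Y w)) \<in> borel_measurable M"
  unfolding quad_form_def grad_norm_def L2_set_def ip_def using assms by measurable

section \<open>Concentration of quadratic forms\<close>

lemma lipschitz1_abs: "lipschitz1 I f \<Longrightarrow> \<bar>f x - f y\<bar> \<le> dst I x y"
  unfolding lipschitz1_def using dst_commute[of I x y] by (smt (verit))

lemma quad_form_segment_continuous:
  "continuous_on A (\<lambda>t. quad_form I r v lam (\<lambda>i. y i + t * (x i - y i)))"
  unfolding quad_form_def ip_add ip_scale by (intro continuous_intros) auto

text \<open>A random vector with a diagonalized quadratic form. Eigenvalues are bounded by
  \<open>2 * K\<close> so that \<open>K\<close> is the constant of the quadratic remainder;
  \<open>K > 0\<close> allows the division in \<open>\<psi> / (2 * K)\<close>, and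
  \<open>K = 0\<close> is settled in \<open>trace_concentratedI\<close>.\<close>

locale random_vector = prob_space M for M :: "'w measure" +
  fixes Y :: "'w \<Rightarrow> 'i :: countable \<Rightarrow> real" and I :: "'i set"
    and r :: nat and v :: "nat \<Rightarrow> 'i \<Rightarrow> real" and lam :: "nat \<Rightarrow> real" and K :: real
  assumes finite_I: "finite I"
    and Y_measurable: "\<And>i. i \<in> I \<Longrightarrow> (\<lambda>w. Y w i) \<in> borel_measurable M"
    and orthonormal: "orthonormal_family I r v"
    and lam_le: "\<And>k. k < r \<Longrightarrow> \<bar>lam k\<bar> \<le> 2 * K"
    and K_pos: "K > 0"
begin

abbreviation (input) "\<phi> \<equiv> quad_form I r v lam"
abbreviation (input) "\<psi> \<equiv> grad_norm I r v lam"

lemma lip_meas: "lipschitz1 I f \<Longrightarrow> (\<lambda>w. f (Y w)) \<in> borel_measurable M"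
  by (rule lipschitz1_measurable[OF finite_I Y_measurable])

lemma quad_meas[measurable]:
  "(\<lambda>w. quad_form I r v l (Y w)) \<in> borel_measurable M"
  "(\<lambda>w. grad_norm I r v l (Y w)) \<in> borel_measurable M"
  by (rule quad_form_measurable, rule Y_measurable, assumption)+

lemma scaled_grad_norm_lipschitz: "lipschitz1 I (\<lambda>x. \<psi> x / (2 * K))"
  unfolding lipschitz1_def
proof (intro allI)
  fix x y
  have "(\<psi> x - \<psi> y) / (2 * K) \<le> dst I x y"
    using grad_norm_lipschitz[where x=x and y=y, OF orthonormal lam_le] K_pos by (simp add: divide_le_eq mult.commute)
  then show "\<psi> x / (2 * K) - \<psi> y / (2 * K) \<le> dst I x y" by (simp add: diff_divide_distrib)
qed

lemma scaled_grad_norm_convex: "convex_fun (\<lambda>x. \<psi> x / (2 * K))"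
  using grad_norm_convex[of I r v lam] K_pos
  unfolding convex_fun_def by (auto simp: divide_right_mono add_divide_distrib[symmetric])

text \<open>The signed distance to the level set of \<open>\<phi>\<close> at its median has median 0, so that no
  recentring is needed.\<close>

lemma quad_form_concentration:
  assumes conc: "\<And>f m. lipschitz1 I f \<Longrightarrow> is_median M (\<lambda>w. f (Y w)) m \<Longrightarrow>
      prob {w \<in> space M. \<bar>f (Y w) - m\<bar> > s} \<le> u"
    and a: "is_median M (\<lambda>w. \<phi> (Y w)) a" and m: "is_median M (\<lambda>w. \<psi> (Y w)) m" and s: "s \<ge> 0"
  shows "prob {w \<in> space M. \<bar>\<phi> (Y w) - a\<bar> > m * s + 3 * K * s\<^sup>2} \<le> 2 * u"
proof -
  define L U where "L = {x. \<phi> x \<le> a}" and "U = {x. \<phi> x \<ge> a}"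
  have half: "prob {w \<in> space M. \<phi> (Y w) \<ge> a} \<ge> 1 / 2" "prob {w \<in> space M. \<phi> (Y w) \<le> a} \<ge> 1 / 2"
    using a unfolding is_median_def by auto
  have "L \<noteq> {}"
  proof
    assume "L = {}"
    then have none: "{w \<in> space M. \<phi> (Y w) \<le> a} = {}" unfolding L_def by auto
    show False using half(2) unfolding none by simp
  qed
  moreover have "U \<noteq> {}"
  proof
    assume "U = {}"
    then have none: "{w \<in> space M. \<phi> (Y w) \<ge> a} = {}" unfolding U_def by auto
    show False using half(1) unfolding none by simp
  qed
  ultimately have ne: "L \<noteq> {}" "U \<noteq> {}" by auto
  define f where "f x = set_dist I L x - set_dist I U x" for x
  have fL: "f x = - set_dist I U x" "f x \<le> 0" if "x \<in> L" for x
    using set_dist_eq_0[OF that] set_dist_nonneg[OF ne(2), of I x] unfolding f_def by auto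
  have fU: "f x = set_dist I L x" "f x \<ge> 0" if "x \<in> U" for x
    using set_dist_eq_0[OF that] set_dist_nonneg[OF ne(1), of I x] unfolding f_def by auto
  have LU: "x \<in> L \<or> x \<in> U" for x unfolding L_def U_def by auto
  have f_lip: "lipschitz1 I f"
    unfolding lipschitz1_def
  proof (intro allI)
    fix x y
    consider "x \<in> L" "y \<in> L" | "x \<in> U" "y \<in> U" | "x \<in> L" "y \<in> U" | "x \<in> U" "y \<in> L"
      using LU by blast
    then show "f x - f y \<le> dst I x y"
    proof cases
      case 1
      then show ?thesis using lipschitz1_abs[OF set_dist_lipschitz[OF ne(2)], of I x y] fL(1) by auto
    next
      case 2
      then show ?thesis using lipschitz1_abs[OF set_dist_lipschitz[OF ne(1)], of I x y] fU(1) by auto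
    next
      case 3
      then show ?thesis using fL(2)[of x] fU(2)[of y] dst_nonneg[of I x y] by linarith
    next
      case 4
      \<comment> \<open>The segment from \<open>y\<close> to \<open>x\<close> meets the level set at
        some \<open>z\<close> in both \<open>L\<close> and \<open>U\<close>; the two distances then
        add up to at most the length of the segment.\<close>
      have "\<exists>t\<ge>0. t \<le> 1 \<and> \<phi> (\<lambda>i. y i + t * (x i - y i)) = a"
        by (rule IVT') (use 4 quad_form_segment_continuous in \<open>auto simp: L_def U_def\<close>)
      then obtain t where t: "0 \<le> t" "t \<le> 1" "\<phi> (\<lambda>i. y i + t * (x i - y i)) = a" by blast
      define z where "z = (\<lambda>i. y i + t * (x i - y i))"
      have z: "z \<in> L" "z \<in> U" unfolding L_def U_def z_def using t(3) by auto
      have "f x - f y = set_dist I L x + set_dist I U y" using 4 fL(1) fU(1) by simp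
      also have "\<dots> \<le> dst I x z + dst I z y"
        using set_dist_le[OF z(1), of I x] set_dist_le[OF z(2), of I y] dst_commute[of I y z] by simp
      also have "\<dots> = dst I x y"
        unfolding z_def dst_segment[OF t(1,2)] by (simp add: algebra_simps)
      finally show ?thesis .
    qed
  qed
  note [measurable] = lip_meas[OF f_lip]
  have "is_median M (\<lambda>w. f (Y w)) 0"
    unfolding is_median_def
  proof
    have "prob {w \<in> space M. \<phi> (Y w) \<ge> a} \<le> prob {w \<in> space M. f (Y w) \<ge> 0}"
      using fU(2) by (intro finite_measure_mono) (auto simp: U_def)
    then show "prob {w \<in> space M. f (Y w) \<ge> 0} \<ge> 1 / 2" using half by simp
    have "prob {w \<in> space M. \<phi> (Y w) \<le> a} \<le> prob {w \<in> space M. f (Y w) \<le> 0}"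
      using fL(2) by (intro finite_measure_mono) (auto simp: L_def)
    then show "prob {w \<in> space M. f (Y w) \<le> 0} \<ge> 1 / 2" using half by simp
  qed
  from conc[OF f_lip this] have pf: "prob {w \<in> space M. \<bar>f (Y w)\<bar> > s} \<le> u" by simp
  have "is_median M (\<lambda>w. \<psi> (Y w) / (2 * K)) (m / (2 * K))"
    using m K_pos unfolding is_median_def by (simp add: divide_le_cancel)
  from conc[OF scaled_grad_norm_lipschitz this]
  have pg: "prob {w \<in> space M. \<bar>\<psi> (Y w) / (2 * K) - m / (2 * K)\<bar> > s} \<le> u" .
  have close: "\<bar>\<phi> x - a\<bar> \<le> m * s + 3 * K * s\<^sup>2"
    if f: "\<bar>f x\<bar> \<le> s" and g: "\<bar>\<psi> x / (2 * K) - m / (2 * K)\<bar> \<le> s" for x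
  proof -
    have "(\<psi> x - m) / (2 * K) \<le> s" using g by (simp add: diff_divide_distrib)
    then have gx: "\<psi> x \<le> m + 2 * K * s" using K_pos by (simp add: divide_le_eq mult.commute)
    \<comment> \<open>Instead of a nearest point, points closer than \<open>e > s\<close> are used,
      and \<open>e\<close> tends to \<open>s\<close>.\<close>
    have "\<bar>\<phi> x - a\<bar> \<le> \<psi> x * s + K * s\<^sup>2"
    proof (rule tendsto_lowerbound)
      show "((\<lambda>e. \<psi> x * e + K * e\<^sup>2) \<longlongrightarrow> \<psi> x * s + K * s\<^sup>2) (at_right s)"
        by (intro tendsto_intros)
      have "\<bar>\<phi> x - a\<bar> \<le> \<psi> x * e + K * e\<^sup>2" if e: "e > s" for e
      proof -
        \<comment> \<open>Take \<open>y\<close> on the opposite side of the level \<open>a\<close>,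
          which then lies between \<open>\<phi> x\<close> and \<open>\<phi> y\<close>.\<close>
        have "\<exists>y. dst I x y < e \<and> \<bar>\<phi> x - a\<bar> \<le> \<bar>\<phi> y - \<phi> x\<bar>"
        proof (cases "x \<in> L")
          case True
          then have "set_dist I U x < e" using f fL(1) e by fastforce
          from set_dist_lessD[OF ne(2) this] obtain y where "y \<in> U" "dst I x y < e" by blast
          then show ?thesis using True unfolding L_def U_def by (intro exI[of _ y]) auto
        next
          case False
          then have xU: "x \<in> U" using LU by blast
          then have "set_dist I L x < e" using f fU(1) e by fastforce
          from set_dist_lessD[OF ne(1) this] obtain y where "y \<in> L" "dst I x y < e" by blast
          then show ?thesis using xU unfolding L_def U_def by (intro exI[of _ y]) auto
        qed
        then obtain y where y: "dst I x y < e" "\<bar>\<phi> x - a\<bar> \<le> \<bar>\<phi> y - \<phi> x\<bar>" by blast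
        have "\<bar>\<phi> y - \<phi> x\<bar> \<le> \<psi> x * dst I x y + K * (dst I x y)\<^sup>2"
          using quad_form_diff_le[where x=y and y=x, OF orthonormal lam_le] K_pos dst_commute[of I x y] by simp
        also have "\<dots> \<le> \<psi> x * e + K * e\<^sup>2"
          using y(1) K_pos by (intro add_mono mult_left_mono power_mono) auto
        finally show ?thesis using y(2) by simp
      qed
      then show "\<forall>\<^sub>F e in at_right s. \<bar>\<phi> x - a\<bar> \<le> \<psi> x * e + K * e\<^sup>2"
        by (auto simp: eventually_at_filter)
    qed simp
    also have "\<dots> \<le> (m + 2 * K * s) * s + K * s\<^sup>2" using gx s by (simp add: mult_right_mono)
    \<comment> \<open>Source of the 3: the growth of the gradient contributes
      \<open>2 * K * s\<^sup>2\<close> and the quadratic remainder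
      \<open>K * s\<^sup>2\<close>.\<close>
    also have "\<dots> = m * s + 3 * K * s\<^sup>2" by (simp add: algebra_simps power2_eq_square)
    finally show ?thesis .
  qed
  have "prob {w \<in> space M. \<bar>\<phi> (Y w) - a\<bar> > m * s + 3 * K * s\<^sup>2}
    \<le> prob ({w \<in> space M. \<bar>f (Y w)\<bar> > s} \<union> {w \<in> space M. \<bar>\<psi> (Y w) / (2 * K) - m / (2 * K)\<bar> > s})"
    using close by (intro finite_measure_mono) (fastforce simp: not_le[symmetric])+
  also have "\<dots> \<le> prob {w \<in> space M. \<bar>f (Y w)\<bar> > s} + prob {w \<in> space M. \<bar>\<psi> (Y w) / (2 * K) - m / (2 * K)\<bar> > s}"
    by (rule measure_Un_le) measurable
  finally show ?thesis using pf pg by simp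
qed

lemma convex_sublevel:
  assumes "convex_fun f" "f x \<le> c" "f y \<le> c" "a \<ge> 0" "b \<ge> 0" "a + b = (1::real)"
  shows "f (\<lambda>i. a * x i + b * y i) \<le> c"
proof -
  have "f (\<lambda>i. a * x i + b * y i) \<le> a * f x + b * f y" using assms unfolding convex_fun_def by blast
  also have "\<dots> \<le> a * c + b * c" using assms by (intro add_mono mult_left_mono) auto
  also have "\<dots> = c" using assms by (simp add: distrib_right[symmetric])
  finally show ?thesis .
qed

section \<open>The convex setting at a fixed level \<open>s\<close> with tail bound
  \<open>u\<close>\<close>

context
  fixes s u m :: real
  assumes conc: "\<And>f m. lipschitz1 I f \<Longrightarrow> convex_fun f \<Longrightarrow> is_median M (\<lambda>w. f (Y w)) m \<Longrightarrow>
      prob {w \<in> space M. \<bar>f (Y w) - m\<bar> > s} \<le> u"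
    and m: "is_median M (\<lambda>w. \<psi> (Y w)) m" and s: "s \<ge> 0"
begin

lemma median_grad_norm_nonneg: "m \<ge> 0"
proof (rule ccontr)
  assume "\<not> m \<ge> 0"
  then have "\<not> \<psi> x \<le> m" for x using grad_norm_nonneg[of I r v lam x] by linarith
  then have none: "{w \<in> space M. \<psi> (Y w) \<le> m} = {}" by simp
  show False using m unfolding is_median_def none by simp
qed

text \<open>A deviation \<open>s\<close> of the 1-Lipschitz function \<open>\<psi> / (2 * K)\<close>
  is a deviation \<open>2 * K * s\<close> of \<open>\<psi>\<close>.\<close>

lemma grad_norm_tail: "prob {w \<in> space M. \<psi> (Y w) > m + 2 * K * s} \<le> u"
proof -
  have "is_median M (\<lambda>w. \<psi> (Y w) / (2 * K)) (m / (2 * K))"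
    using m K_pos unfolding is_median_def by (simp add: divide_le_cancel)
  from conc[OF scaled_grad_norm_lipschitz scaled_grad_norm_convex this]
  have "prob {w \<in> space M. \<bar>\<psi> (Y w) / (2 * K) - m / (2 * K)\<bar> > s} \<le> u" .
  moreover have "prob {w \<in> space M. \<psi> (Y w) > m + 2 * K * s}
    \<le> prob {w \<in> space M. \<bar>\<psi> (Y w) / (2 * K) - m / (2 * K)\<bar> > s}"
  proof (rule finite_measure_mono)
    have "\<bar>\<psi> x / (2 * K) - m / (2 * K)\<bar> > s" if "\<psi> x > m + 2 * K * s" for x
    proof -
      have "(\<psi> x - m) / (2 * K) > s" using that K_pos by (simp add: less_divide_eq mult.commute)
      then show ?thesis by (simp add: diff_divide_distrib)
    qed
    then show "{w \<in> space M. \<psi> (Y w) > m + 2 * K * s}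
      \<subseteq> {w \<in> space M. \<bar>\<psi> (Y w) / (2 * K) - m / (2 * K)\<bar> > s}" by blast
  qed measurable
  ultimately show ?thesis by simp
qed

lemma u_nonneg: "u \<ge> 0"
  using grad_norm_tail measure_nonneg[of M] by (meson order_trans)

section \<open>Tails of a convex form dominated by \<open>lam\<close>, such as its positive or
  negative part\<close>

context
  fixes lam' :: "nat \<Rightarrow> real" and a :: real
  assumes lam': "\<And>k. k < r \<Longrightarrow> 0 \<le> lam' k \<and> lam' k \<le> \<bar>lam k\<bar>"
    and a: "is_median M (\<lambda>w. quad_form I r v lam' (Y w)) a"
begin

abbreviation (input) "g \<equiv> quad_form I r v lam'"

lemma grad_norm_le: "grad_norm I r v lam' x \<le> \<psi> x"
  by (rule grad_norm_mono) (use lam' in force)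

lemma g_diff_le: "g x - g y \<le> \<psi> y * dst I x y + K * (dst I x y)\<^sup>2"
proof -
  have "\<bar>g x - g y\<bar> \<le> grad_norm I r v lam' y * dst I x y + K * (dst I x y)\<^sup>2"
    by (rule quad_form_diff_le[OF orthonormal]) (use lam' lam_le K_pos in force)+
  also have "grad_norm I r v lam' y * dst I x y \<le> \<psi> y * dst I x y"
    by (intro mult_right_mono grad_norm_le) simp
  finally show ?thesis by simp
qed

text \<open>The distance to the sublevel set at the median is convex and 1-Lipschitz with median 0,
  being nonnegative and zero on half of the mass. Where the gradient is at most
  \<open>\<Lambda>\<close>, a point within \<open>s\<close> of that set exceeds \<open>a\<close> by
  at most \<open>\<Lambda> * s\<close>, by the tangent inequality.\<close>

lemma convex_upper_tail:
  "prob {w \<in> space M. \<psi> (Y w) \<le> m + 2 * K * s \<and> g (Y w) > a + (m + 2 * K * s) * s} \<le> u"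
proof -
  define \<Lambda> where "\<Lambda> = m + 2 * K * s"
  define S where "S = {x. g x \<le> a}"
  have half: "prob {w \<in> space M. g (Y w) \<le> a} \<ge> 1 / 2" using a unfolding is_median_def by auto
  have ne: "S \<noteq> {}"
  proof
    assume "S = {}"
    then have none: "{w \<in> space M. g (Y w) \<le> a} = {}" unfolding S_def by auto
    show False using half unfolding none by simp
  qed
  have gconv: "convex_fun g" by (rule quad_form_convex) (use lam' in blast)
  have lip: "lipschitz1 I (set_dist I S)" by (rule set_dist_lipschitz[OF ne])
  have conv: "convex_fun (set_dist I S)"
    by (rule set_dist_convex[OF ne]) (use convex_sublevel[OF gconv] in \<open>auto simp: S_def\<close>)
  note [measurable] = lip_meas[OF lip]
  have "is_median M (\<lambda>w. set_dist I S (Y w)) 0"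
    unfolding is_median_def
  proof
    have "{w \<in> space M. set_dist I S (Y w) \<ge> 0} = space M" using set_dist_nonneg[OF ne] by auto
    then show "prob {w \<in> space M. set_dist I S (Y w) \<ge> 0} \<ge> 1 / 2" by (simp add: prob_space)
    have "set_dist I S x \<le> 0" if "g x \<le> a" for x
      using set_dist_eq_0[of x S I] that unfolding S_def by simp
    then have "prob {w \<in> space M. g (Y w) \<le> a} \<le> prob {w \<in> space M. set_dist I S (Y w) \<le> 0}"
      by (intro finite_measure_mono) auto
    then show "prob {w \<in> space M. set_dist I S (Y w) \<le> 0} \<ge> 1 / 2" using half by simp
  qed
  from conc[OF lip conv this] have p: "prob {w \<in> space M. \<bar>set_dist I S (Y w)\<bar> > s} \<le> u" by simp
  have far: "set_dist I S x > s" if x: "\<psi> x \<le> \<Lambda>" "g x > a + \<Lambda> * s" for x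
  proof (rule ccontr)
    assume le: "\<not> set_dist I S x > s"
    have "g x - a \<le> \<psi> x * s"
    proof (rule tendsto_lowerbound)
      show "((\<lambda>e. \<psi> x * e) \<longlongrightarrow> \<psi> x * s) (at_right s)" by (intro tendsto_intros)
      have "g x - a \<le> \<psi> x * e" if e: "e > s" for e
      proof -
        obtain y where y: "y \<in> S" "dst I x y < e"
          using set_dist_lessD[OF ne, of I x e] le e by fastforce
        have "g x - a \<le> g x - g y" using y(1) by (simp add: S_def)
        also have "\<dots> \<le> grad_norm I r v lam' x * dst I x y"
          by (rule quad_form_convex_diff_le[OF orthonormal]) (use lam' in blast)
        also have "\<dots> \<le> \<psi> x * e"
          using y(2) by (intro mult_mono grad_norm_le) auto
        finally show ?thesis .
      qed
      then show "\<forall>\<^sub>F e in at_right s. g x - a \<le> \<psi> x * e"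
        by (auto simp: eventually_at_filter)
    qed simp
    also have "\<psi> x * s \<le> \<Lambda> * s" using x s by (intro mult_right_mono)
    finally show False using x(2) by simp
  qed
  have "prob {w \<in> space M. \<psi> (Y w) \<le> \<Lambda> \<and> g (Y w) > a + \<Lambda> * s}
    \<le> prob {w \<in> space M. \<bar>set_dist I S (Y w)\<bar> > s}"
  proof (rule finite_measure_mono)
    have "\<bar>set_dist I S x\<bar> > s" if "\<psi> x \<le> \<Lambda>" "g x > a + \<Lambda> * s" for x
      using far[OF that] by linarith
    then show "{w \<in> space M. \<psi> (Y w) \<le> \<Lambda> \<and> g (Y w) > a + \<Lambda> * s}
      \<subseteq> {w \<in> space M. \<bar>set_dist I S (Y w)\<bar> > s}" by blast
  qed measurable
  then show ?thesis using p unfolding \<Lambda>_def by linarith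
qed

text \<open>Here the distance is taken to a sublevel set of small probability: it vanishes on that set
  and is larger than \<open>s\<close> with probability at least 1/2, hence it has a median larger than \<open>s\<close>.\<close>

lemma convex_lower_tail:
  "prob {w \<in> space M. \<psi> (Y w) \<le> m + 2 * K * s \<and> g (Y w) < a - ((m + 2 * K * s) * s + K * s\<^sup>2)} \<le> u"
proof -
  define \<Lambda> T where "\<Lambda> = m + 2 * K * s" and "T = \<Lambda> * s + K * s\<^sup>2"
  have \<Lambda>: "\<Lambda> \<ge> 0" using median_grad_norm_nonneg s K_pos unfolding \<Lambda>_def by simp
  have half: "prob {w \<in> space M. g (Y w) \<ge> a} \<ge> 1 / 2" using a unfolding is_median_def by auto
  have gconv: "convex_fun g" by (rule quad_form_convex) (use lam' in blast)
  \<comment> \<open>A level \<open>t > T\<close> leaves room for a radius \<open>d > s\<close> with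
    \<open>\<Lambda> * d + K * d\<^sup>2 < t\<close>, so that the median \<open>b \<ge> d\<close> of
    the distance lies strictly beyond \<open>s\<close>. Levels decreasing to \<open>T\<close> then
    give the strict event at \<open>T\<close> by continuity of the measure.\<close>
  have strict: "prob {w \<in> space M. \<psi> (Y w) \<le> \<Lambda> \<and> g (Y w) \<le> a - t} \<le> u" if t: "t > T" for t
  proof -
    \<comment> \<open>The bound on \<open>\<psi>\<close> is part of \<open>S\<close> because the
      expansion in \<open>far\<close> is made at the point \<open>y\<close> of \<open>S\<close>; the
      set stays convex since \<open>\<psi>\<close> is convex.\<close>
    define S where "S = {x. \<psi> x \<le> \<Lambda> \<and> g x \<le> a - t}"
    show ?thesis
    proof (cases "S = {}")
      case True
      then have none: "{w \<in> space M. \<psi> (Y w) \<le> \<Lambda> \<and> g (Y w) \<le> a - t} = {}" unfolding S_def by auto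
      show ?thesis unfolding none using u_nonneg by simp
    next
      case ne: False
      have "((\<lambda>e. \<Lambda> * e + K * e\<^sup>2) \<longlongrightarrow> T) (at_right s)"
        unfolding T_def by (intro tendsto_intros)
      then have "\<forall>\<^sub>F e in at_right s. \<Lambda> * e + K * e\<^sup>2 < t" using t by (rule order_tendstoD)
      then have "\<forall>\<^sub>F e in at_right s. \<Lambda> * e + K * e\<^sup>2 < t \<and> e > s"
        by (intro eventually_conj) (auto simp: eventually_at_filter)
      then obtain d where d: "\<Lambda> * d + K * d\<^sup>2 < t" "d > s"
        using eventually_happens[of _ "at_right s"] by (auto simp: trivial_limit_at_right_real)
      have lip: "lipschitz1 I (set_dist I S)" by (rule set_dist_lipschitz[OF ne])
      have conv: "convex_fun (set_dist I S)"
        by (rule set_dist_convex[OF ne])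
          (use convex_sublevel[OF gconv] convex_sublevel[OF grad_norm_convex] in \<open>auto simp: S_def\<close>)
      note [measurable] = lip_meas[OF lip]
      have far: "set_dist I S x \<ge> d" if x: "g x \<ge> a" for x
      proof (rule set_dist_geI[OF ne], rule ccontr)
        fix y assume y: "y \<in> S" and "\<not> d \<le> dst I x y"
        then have lt: "dst I x y < d" by simp
        have "t \<le> g x - g y" using x y by (simp add: S_def)
        also have "\<dots> \<le> \<psi> y * dst I x y + K * (dst I x y)\<^sup>2" by (rule g_diff_le)
        also have "\<dots> \<le> \<Lambda> * d + K * d\<^sup>2"
          using lt y K_pos \<Lambda> by (intro add_mono mult_mono power_mono) (auto simp: S_def)
        finally show False using d(1) by simp
      qed
      have "prob {w \<in> space M. g (Y w) \<ge> a} \<le> prob {w \<in> space M. set_dist I S (Y w) \<ge> d}"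
        using far by (intro finite_measure_mono) auto
      then have "prob {w \<in> space M. set_dist I S (Y w) \<ge> d} \<ge> 1 / 2" using half by simp
      then obtain b where b: "b \<ge> d" "is_median M (\<lambda>w. set_dist I S (Y w)) b"
        using median_exists_ge[OF lip_meas[OF lip]] by blast
      have "prob {w \<in> space M. \<psi> (Y w) \<le> \<Lambda> \<and> g (Y w) \<le> a - t}
        \<le> prob {w \<in> space M. \<bar>set_dist I S (Y w) - b\<bar> > s}"
      proof (rule finite_measure_mono)
        have "\<bar>set_dist I S x - b\<bar> > s" if "\<psi> x \<le> \<Lambda>" "g x \<le> a - t" for x
          using set_dist_eq_0[of x S I] that b(1) d(2) by (auto simp: S_def)
        then show "{w \<in> space M. \<psi> (Y w) \<le> \<Lambda> \<and> g (Y w) \<le> a - t}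
          \<subseteq> {w \<in> space M. \<bar>set_dist I S (Y w) - b\<bar> > s}" by blast
      qed measurable
      also have "\<dots> \<le> u" by (rule conc[OF lip conv b(2)])
      finally show ?thesis .
    qed
  qed
  have "(\<lambda>k. prob {w \<in> space M. \<psi> (Y w) \<le> \<Lambda> \<and> g (Y w) \<le> a - (T + 1 / real (Suc k))})
      \<longlonglongrightarrow> prob (\<Union>k. {w \<in> space M. \<psi> (Y w) \<le> \<Lambda> \<and> g (Y w) \<le> a - (T + 1 / real (Suc k))})"
  proof (rule finite_Lim_measure_incseq)
    have "a - (T + 1 / real (Suc i)) \<le> a - (T + 1 / real (Suc j))" if "i \<le> j" for i j
      using that by (simp add: frac_le)
    then show "incseq (\<lambda>k. {w \<in> space M. \<psi> (Y w) \<le> \<Lambda> \<and> g (Y w) \<le> a - (T + 1 / real (Suc k))})"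
      unfolding incseq_def by (force intro: order_trans simp del: of_nat_Suc)
  qed auto
  also have "(\<Union>k. {w \<in> space M. \<psi> (Y w) \<le> \<Lambda> \<and> g (Y w) \<le> a - (T + 1 / real (Suc k))})
    = {w \<in> space M. \<psi> (Y w) \<le> \<Lambda> \<and> g (Y w) < a - T}"
  proof -
    have "(\<exists>k. x \<le> a - (T + 1 / real (Suc k))) \<longleftrightarrow> x < a - T" for x
      using reals_Archimedean[of "a - T - x"]
      by (smt (verit) divide_pos_pos of_nat_0_less_iff zero_less_Suc inverse_eq_divide)
    then show ?thesis by auto
  qed
  finally have "prob {w \<in> space M. \<psi> (Y w) \<le> \<Lambda> \<and> g (Y w) < a - T} \<le> u"
    by (rule LIMSEQ_le_const2) (use strict in \<open>auto intro!: exI[of _ 0]\<close>)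
  then show ?thesis unfolding \<Lambda>_def T_def .
qed

text \<open>The upper deviation comes without the quadratic remainder, so the lower one decides the
  common threshold.\<close>

lemma convex_tail:
  "prob {w \<in> space M. \<psi> (Y w) \<le> m + 2 * K * s \<and> \<bar>g (Y w) - a\<bar> > m * s + 3 * K * s\<^sup>2} \<le> 2 * u"
proof -
  let ?U = "{w \<in> space M. \<psi> (Y w) \<le> m + 2 * K * s \<and> g (Y w) > a + (m + 2 * K * s) * s}"
  let ?L = "{w \<in> space M. \<psi> (Y w) \<le> m + 2 * K * s \<and> g (Y w) < a - ((m + 2 * K * s) * s + K * s\<^sup>2)}"
  have eq: "(m + 2 * K * s) * s + K * s\<^sup>2 = m * s + 3 * K * s\<^sup>2"
    by (simp add: algebra_simps power2_eq_square)
  have "K * s\<^sup>2 \<ge> 0" using K_pos by simp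
  then have "{w \<in> space M. \<psi> (Y w) \<le> m + 2 * K * s \<and> \<bar>g (Y w) - a\<bar> > m * s + 3 * K * s\<^sup>2} \<subseteq> ?U \<union> ?L"
    unfolding eq[symmetric] by auto
  then have "prob {w \<in> space M. \<psi> (Y w) \<le> m + 2 * K * s \<and> \<bar>g (Y w) - a\<bar> > m * s + 3 * K * s\<^sup>2}
    \<le> prob (?U \<union> ?L)" by (intro finite_measure_mono) auto
  also have "\<dots> \<le> prob ?U + prob ?L" by (rule measure_Un_le) measurable
  finally show ?thesis using convex_upper_tail convex_lower_tail by linarith
qed

end

text \<open>The form is the difference of its positive and negative parts, which are convex with gradients
  dominated by the gradient of the form.\<close>

lemma quad_form_convex_concentration:
  assumes a: "is_median M (\<lambda>w. \<phi> (Y w)) a"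
  shows "prob {w \<in> space M. \<bar>\<phi> (Y w) - a\<bar> > 4 * (m * s + 3 * K * s\<^sup>2)} \<le> 10 * u"
proof -
  define T where "T = m * s + 3 * K * s\<^sup>2"
  define p q where "p = quad_form I r v (\<lambda>k. max (lam k) 0)" and "q = quad_form I r v (\<lambda>k. max (- lam k) 0)"
  have pq: "\<phi> x = p x - q x" for x
  proof -
    have "(\<Sum>k<r. lam k * (ip I (v k) x)\<^sup>2)
      = (\<Sum>k<r. max (lam k) 0 * (ip I (v k) x)\<^sup>2) - (\<Sum>k<r. max (- lam k) 0 * (ip I (v k) x)\<^sup>2)"
      unfolding sum_subtractf[symmetric] by (rule sum.cong) (auto simp: max_def)
    then show ?thesis unfolding p_def q_def quad_form_def by (simp add: diff_divide_distrib)
  qed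
  have [measurable]: "(\<lambda>w. p (Y w)) \<in> borel_measurable M" "(\<lambda>w. q (Y w)) \<in> borel_measurable M"
    unfolding p_def q_def by measurable
  obtain b where b: "is_median M (\<lambda>w. p (Y w)) b" using median_exists[of "\<lambda>w. p (Y w)"] by auto
  obtain c where c: "is_median M (\<lambda>w. q (Y w)) c" using median_exists[of "\<lambda>w. q (Y w)"] by auto
  let ?E = "{w \<in> space M. \<psi> (Y w) > m + 2 * K * s}"
  let ?P = "{w \<in> space M. \<psi> (Y w) \<le> m + 2 * K * s \<and> \<bar>p (Y w) - b\<bar> > T}"
  let ?Q = "{w \<in> space M. \<psi> (Y w) \<le> m + 2 * K * s \<and> \<bar>q (Y w) - c\<bar> > T}"
  let ?B = "{w \<in> space M. \<bar>\<phi> (Y w) - (b - c)\<bar> > 2 * T}"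
  have "prob ?P \<le> 2 * u" unfolding p_def T_def
    by (rule convex_tail) (use b in \<open>auto simp: p_def\<close>)
  moreover have "prob ?Q \<le> 2 * u" unfolding q_def T_def
    by (rule convex_tail) (use c in \<open>auto simp: q_def\<close>)
  \<comment> \<open>Off \<open>?E\<close>, a deviation of \<open>p - q\<close> beyond
    \<open>2 * T\<close> forces one of the parts beyond \<open>T\<close>. The total
    \<open>5 * u\<close> is \<open>u\<close> for the gradient and \<open>2 * u\<close> for each
    part.\<close>
  moreover have "prob ?B \<le> prob (?E \<union> (?P \<union> ?Q))"
    by (rule finite_measure_mono) (auto simp: pq)
  moreover have "prob (?E \<union> (?P \<union> ?Q)) \<le> prob ?E + (prob ?P + prob ?Q)"
    by (intro order_trans[OF measure_Un_le] add_left_mono measure_Un_le) measurable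
  ultimately have B: "prob ?B \<le> 5 * u" using grad_norm_tail by linarith
  show ?thesis
  \<comment> \<open>For \<open>u \<ge> 1 / 10\<close> the bound \<open>10 * u\<close> is at least 1.
    Otherwise \<open>?B\<close> has mass below 1/2, so neither half-mass event at \<open>a\<close>
    fits inside it and \<open>a\<close> is within \<open>2 * T\<close> of
    \<open>b - c\<close>.\<close>
  proof (cases "u < 1 / 10")
    case False
    then show ?thesis using prob_le_1[of "{w \<in> space M. \<bar>\<phi> (Y w) - a\<bar> > 4 * (m * s + 3 * K * s\<^sup>2)}"] by linarith
  next
    case True
    then have B': "prob ?B < 1 / 2" using B by linarith
    have "a \<le> b - c + 2 * T"
    proof (rule ccontr)
      assume "\<not> a \<le> b - c + 2 * T"
      then have "prob {w \<in> space M. \<phi> (Y w) \<ge> a} \<le> prob ?B" by (intro finite_measure_mono) auto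
      then show False using a B' unfolding is_median_def by linarith
    qed
    moreover have "a \<ge> b - c - 2 * T"
    proof (rule ccontr)
      assume "\<not> a \<ge> b - c - 2 * T"
      then have "prob {w \<in> space M. \<phi> (Y w) \<le> a} \<le> prob ?B" by (intro finite_measure_mono) auto
      then show False using a B' unfolding is_median_def by linarith
    qed
    ultimately have "prob {w \<in> space M. \<bar>\<phi> (Y w) - a\<bar> > 4 * T} \<le> prob ?B"
      by (intro finite_measure_mono) auto
    then show ?thesis using B u_nonneg unfolding T_def by linarith
  qed
qed

end

end

section \<open>Matrices\<close>

definition op_bounded :: "nat \<Rightarrow> nat \<Rightarrow> (nat \<Rightarrow> nat \<Rightarrow> real) \<Rightarrow> real \<Rightarrow> bool" where
  "op_bounded p q a c \<longleftrightarrow> (\<forall>v. L2_set (\<lambda>k. \<Sum>h<q. a k h * v h) {..<p} \<le> c * L2_set v {..<q})"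

text \<open>For \<open>w\<close> the transpose applied to \<open>u\<close>, the squared norm of
  \<open>w\<close> is the inner product of \<open>u\<close> with the kernel applied to
  \<open>w\<close>; Cauchy-Schwarz and cancelling one factor give the bound.\<close>

lemma op_bounded_transpose:
  assumes a: "op_bounded p q a c" and c: "c \<ge> 0"
  shows "op_bounded q p (\<lambda>h k. a k h) c"
  unfolding op_bounded_def
proof
  fix u :: "nat \<Rightarrow> real"
  define w where "w h = (\<Sum>k<p. a k h * u k)" for h
  have "(L2_set w {..<q})\<^sup>2 = (\<Sum>h<q. (\<Sum>k<p. a k h * u k) * w h)"
    unfolding ip_self[symmetric] ip_def by (simp only: w_def)
  also have "\<dots> = (\<Sum>h<q. \<Sum>k<p. u k * (a k h * w h))"
    by (simp add: sum_distrib_left sum_distrib_right mult_ac)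
  also have "\<dots> = ip {..<p} u (\<lambda>k. \<Sum>h<q. a k h * w h)"
    unfolding ip_def by (subst sum.swap) (simp add: sum_distrib_left)
  also have "\<dots> \<le> L2_set u {..<p} * L2_set (\<lambda>k. \<Sum>h<q. a k h * w h) {..<p}"
    using ip_Cauchy_Schwarz[of "{..<p}" u "\<lambda>k. \<Sum>h<q. a k h * w h"] by linarith
  also have "\<dots> \<le> L2_set u {..<p} * (c * L2_set w {..<q})"
    using a unfolding op_bounded_def by (intro mult_left_mono) auto
  finally have le: "L2_set w {..<q} * L2_set w {..<q} \<le> (c * L2_set u {..<p}) * L2_set w {..<q}"
    by (simp add: power2_eq_square mult_ac)
  have "L2_set w {..<q} \<le> c * L2_set u {..<p}"
  proof (cases "L2_set w {..<q} = 0")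
    case False
    then have "L2_set w {..<q} > 0" using L2_set_nonneg[of w "{..<q}"] by linarith
    then show ?thesis using le by simp
  qed (use c in simp)
  then show "L2_set (\<lambda>h. \<Sum>k<p. a k h * u k) {..<q} \<le> c * L2_set u {..<p}" unfolding w_def .
qed

lemma L2_set_cartesian:
  "(L2_set x ({..<p} \<times> {..<n}))\<^sup>2 = (\<Sum>k<p. \<Sum>j<n. (x (k, j))\<^sup>2)" for p n :: nat
  unfolding L2_set_def by (simp add: sum_nonneg sum.cartesian_product case_prod_beta')

text \<open>Frobenius norm of a triple product: \<open>b\<close> acts on each row of
  \<open>x\<close>, through its transpose, and \<open>a\<close> on each column of the result; the
  squares are summed.\<close>

lemma op_bounded_sandwich:
  assumes a: "op_bounded p p a c" and c: "c \<ge> 0" and b: "op_bounded n n b d" and d: "d \<ge> 0"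
  shows "L2_set (\<lambda>(k, j). \<Sum>h<p. a k h * (\<Sum>i<n. x (h, i) * b i j)) ({..<p} \<times> {..<n})
    \<le> c * d * L2_set x ({..<p} \<times> {..<n})"
proof -
  let ?I = "{..<p} \<times> {..<n}"
  define y where "y hj = (case hj of (h, j) \<Rightarrow> \<Sum>i<n. x (h, i) * b i j)" for hj
  have sq: "(L2_set v {..<q})\<^sup>2 = (\<Sum>k<q. (v k)\<^sup>2)" for v :: "nat \<Rightarrow> real" and q
    by (simp add: L2_set_def sum_nonneg)
  have bt: "op_bounded n n (\<lambda>j i. b i j) d" by (rule op_bounded_transpose[OF b d])
  have row: "(\<Sum>j<n. (y (h, j))\<^sup>2) \<le> d\<^sup>2 * (\<Sum>i<n. (x (h, i))\<^sup>2)" for h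
  proof -
    have "(\<Sum>j<n. (y (h, j))\<^sup>2) = (L2_set (\<lambda>j. \<Sum>i<n. b i j * x (h, i)) {..<n})\<^sup>2"
      unfolding sq y_def by (simp add: mult.commute)
    also have "\<dots> \<le> (d * L2_set (\<lambda>i. x (h, i)) {..<n})\<^sup>2"
      using bt unfolding op_bounded_def by (intro power_mono) auto
    finally show ?thesis unfolding power_mult_distrib sq .
  qed
  have col: "(\<Sum>k<p. (\<Sum>h<p. a k h * y (h, j))\<^sup>2) \<le> c\<^sup>2 * (\<Sum>h<p. (y (h, j))\<^sup>2)" for j
  proof -
    have "(\<Sum>k<p. (\<Sum>h<p. a k h * y (h, j))\<^sup>2) = (L2_set (\<lambda>k. \<Sum>h<p. a k h * y (h, j)) {..<p})\<^sup>2"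
      unfolding sq ..
    also have "\<dots> \<le> (c * L2_set (\<lambda>h. y (h, j)) {..<p})\<^sup>2"
      using a unfolding op_bounded_def by (intro power_mono) auto
    finally show ?thesis unfolding power_mult_distrib sq .
  qed
  have "(L2_set (\<lambda>(k, j). \<Sum>h<p. a k h * (\<Sum>i<n. x (h, i) * b i j)) ?I)\<^sup>2
    = (\<Sum>j<n. \<Sum>k<p. (\<Sum>h<p. a k h * y (h, j))\<^sup>2)"
    unfolding L2_set_cartesian by (subst sum.swap) (simp add: y_def)
  also have "\<dots> \<le> (\<Sum>j<n. c\<^sup>2 * (\<Sum>h<p. (y (h, j))\<^sup>2))" by (intro sum_mono col)
  also have "\<dots> = c\<^sup>2 * (\<Sum>h<p. \<Sum>j<n. (y (h, j))\<^sup>2)"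
    by (simp add: sum_distrib_left[symmetric] sum.swap[of _ "{..<n}" "{..<p}"])
  also have "\<dots> \<le> c\<^sup>2 * (\<Sum>h<p. d\<^sup>2 * (\<Sum>i<n. (x (h, i))\<^sup>2))"
    by (intro mult_left_mono sum_mono row) simp
  also have "\<dots> = (c * d * L2_set x ?I)\<^sup>2"
    unfolding power_mult_distrib L2_set_cartesian by (simp add: sum_distrib_left mult_ac)
  finally show ?thesis using c d by (simp add: power2_le_iff_abs_le abs_of_nonneg)
qed

lemma euclidean_norm_L2_set: "euclidean_norm v = L2_set (\<lambda>i. v $ i) {..<dim_vec v}"
  unfolding euclidean_norm_def scalar_prod_def L2_set_def
  by (simp add: power2_eq_square lessThan_atLeast0)

lemma euclidean_norm_mult_mat_vec:
  assumes "A \<in> carrier_mat p q"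
  shows "euclidean_norm (A *\<^sub>v vec q v) = L2_set (\<lambda>k. \<Sum>h<q. A $$ (k, h) * v h) {..<p}"
  unfolding euclidean_norm_L2_set using assms
  by (auto intro!: L2_set_cong sum.cong simp: scalar_prod_def lessThan_atLeast0)

text \<open>The supremum in \<open>spectral_norm\<close> has to be shown finite first: coordinates
  in the unit ball are at most 1, so the sum of the absolute entries of \<open>A\<close> is a bound.
  Scaling to norm 1 then covers every \<open>v\<close>.\<close>

lemma spectral_norm_bounded:
  assumes A: "A \<in> carrier_mat p q"
  shows "spectral_norm A \<ge> 0" "op_bounded p q (\<lambda>k h. A $$ (k, h)) (spectral_norm A)"
proof -
  define S where "S = {v \<in> carrier_vec q. euclidean_norm v \<le> 1}"
  have norm: "spectral_norm A = (SUP v \<in> S. euclidean_norm (A *\<^sub>v v))"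
    unfolding spectral_norm_def S_def using A by auto
  have vec_eq: "v = vec q (\<lambda>i. v $ i)" if "v \<in> S" for v :: "real vec"
    using that unfolding S_def by auto
  have bdd: "bdd_above ((\<lambda>v. euclidean_norm (A *\<^sub>v v)) ` S)"
  proof (rule bdd_aboveI2)
    fix v assume v: "v \<in> S"
    have v1: "\<bar>v $ h\<bar> \<le> 1" if "h < q" for h
    proof -
      have "\<bar>v $ h\<bar> \<le> L2_set (\<lambda>i. \<bar>v $ i\<bar>) {..<q}" using that by (intro member_le_L2_set) auto
      also have "\<dots> = euclidean_norm v"
        using v unfolding euclidean_norm_L2_set S_def L2_set_def by auto
      finally show ?thesis using v unfolding S_def by simp
    qed
    have "euclidean_norm (A *\<^sub>v v) = L2_set (\<lambda>k. \<Sum>h<q. A $$ (k, h) * v $ h) {..<p}"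
      using euclidean_norm_mult_mat_vec[OF A, of "\<lambda>i. v $ i"] vec_eq[OF v] by simp
    also have "\<dots> \<le> (\<Sum>k<p. \<bar>\<Sum>h<q. A $$ (k, h) * v $ h\<bar>)" by (rule L2_set_le_sum_abs)
    also have "\<dots> \<le> (\<Sum>k<p. \<Sum>h<q. \<bar>A $$ (k, h)\<bar>)"
    proof (intro sum_mono order_trans[OF sum_abs])
      fix k h assume "h \<in> {..<q}"
      then show "\<bar>A $$ (k, h) * v $ h\<bar> \<le> \<bar>A $$ (k, h)\<bar>"
        using mult_left_mono[OF v1[of h], of "\<bar>A $$ (k, h)\<bar>"] by (simp add: abs_mult)
    qed
    finally show "euclidean_norm (A *\<^sub>v v) \<le> (\<Sum>k<p. \<Sum>h<q. \<bar>A $$ (k, h)\<bar>)" .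
  qed
  have in_S: "vec q v \<in> S \<longleftrightarrow> L2_set v {..<q} \<le> 1" for v
  proof -
    have "euclidean_norm (vec q v) = L2_set v {..<q}"
      unfolding euclidean_norm_L2_set by (auto intro!: L2_set_cong)
    then show ?thesis unfolding S_def by auto
  qed
  have upper: "L2_set (\<lambda>k. \<Sum>h<q. A $$ (k, h) * v h) {..<p} \<le> spectral_norm A"
    if "L2_set v {..<q} \<le> 1" for v
    unfolding norm euclidean_norm_mult_mat_vec[OF A, symmetric]
    by (rule cSUP_upper[OF _ bdd]) (use in_S that in blast)
  have "0 \<le> L2_set (\<lambda>k. \<Sum>h<q. A $$ (k, h) * 0) {..<p}" by simp
  also have "\<dots> \<le> spectral_norm A" by (rule upper) (simp add: L2_set_def)
  finally show nonneg: "spectral_norm A \<ge> 0" .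
  show "op_bounded p q (\<lambda>k h. A $$ (k, h)) (spectral_norm A)"
    unfolding op_bounded_def
  proof
    fix v :: "nat \<Rightarrow> real"
    define N where "N = L2_set v {..<q}"
    show "L2_set (\<lambda>k. \<Sum>h<q. A $$ (k, h) * v h) {..<p} \<le> spectral_norm A * L2_set v {..<q}"
    proof (cases "N = 0")
      case True
      then have "\<forall>h<q. v h = 0" unfolding N_def by (auto simp: L2_set_eq_0_iff)
      then show ?thesis using nonneg by (simp add: L2_set_def)
    next
      case False
      then have N: "N > 0" unfolding N_def using L2_set_nonneg[of v "{..<q}"] by linarith
      have "L2_set (\<lambda>h. (1 / N) * v h) {..<q} = 1"
        unfolding L2_set_abs_scale using N by (simp add: N_def)
      then have "L2_set (\<lambda>k. \<Sum>h<q. A $$ (k, h) * ((1 / N) * v h)) {..<p} \<le> spectral_norm A"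
        by (intro upper) simp
      also have "(\<lambda>k. \<Sum>h<q. A $$ (k, h) * ((1 / N) * v h)) = (\<lambda>k. (1 / N) * (\<Sum>h<q. A $$ (k, h) * v h))"
        by (simp add: sum_distrib_left mult_ac)
      also have "L2_set \<dots> {..<p} = (1 / N) * L2_set (\<lambda>k. \<Sum>h<q. A $$ (k, h) * v h) {..<p}"
        unfolding L2_set_abs_scale using N by simp
      finally show ?thesis using N unfolding N_def by (simp add: field_simps)
    qed
  qed
qed

section \<open>The trace form as a kernel form\<close>

definition trace_kernel :: "real mat \<Rightarrow> real mat \<Rightarrow> nat \<times> nat \<Rightarrow> nat \<times> nat \<Rightarrow> real" where
  "trace_kernel A B = (\<lambda>(k, j) (h, i). A $$ (k, h) * B $$ (i, j) + A $$ (h, k) * B $$ (j, i))"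

lemma trace_kernel_sym: "trace_kernel A B a b = trace_kernel A B b a"
  unfolding trace_kernel_def by (auto split: prod.splits)

text \<open>In matrix terms this is \<open>A x B + A^T x B^T\<close>, the gradient of
  \<open>Tr (B x^T A x)\<close> at \<open>x\<close>.\<close>

lemma kernel_app_trace_kernel:
  "kernel_app ({..<p} \<times> {..<n}) (trace_kernel A B) x (k, j) =
    (\<Sum>h<p. A $$ (k, h) * (\<Sum>i<n. x (h, i) * B $$ (i, j)))
    + (\<Sum>h<p. A $$ (h, k) * (\<Sum>i<n. x (h, i) * B $$ (j, i)))"
proof -
  have "kernel_app ({..<p} \<times> {..<n}) (trace_kernel A B) x (k, j)
    = (\<Sum>h<p. \<Sum>i<n. (A $$ (k, h) * B $$ (i, j) + A $$ (h, k) * B $$ (j, i)) * x (h, i))"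
    unfolding kernel_app_def trace_kernel_def by (simp add: sum.cartesian_product case_prod_beta')
  then show ?thesis by (simp add: sum.distrib sum_distrib_left algebra_simps)
qed

text \<open>Each of the two summands is a triple product of norm at most
  \<open>spectral_norm A * spectral_norm B\<close>; this is the origin of the eigenvalue bound
  \<open>2 * K\<close>.\<close>

lemma trace_kernel_bounded:
  assumes A: "A \<in> carrier_mat p p" and B: "B \<in> carrier_mat n n"
  shows "L2_set (kernel_app ({..<p} \<times> {..<n}) (trace_kernel A B) x) ({..<p} \<times> {..<n})
    \<le> 2 * (spectral_norm A * spectral_norm B) * L2_set x ({..<p} \<times> {..<n})"
proof -
  let ?I = "{..<p} \<times> {..<n}"
  note a = spectral_norm_bounded[OF A] and b = spectral_norm_bounded[OF B]
  define T1 where "T1 = (\<lambda>(k, j). \<Sum>h<p. A $$ (k, h) * (\<Sum>i<n. x (h, i) * B $$ (i, j)))"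
  define T2 where "T2 = (\<lambda>(k, j). \<Sum>h<p. A $$ (h, k) * (\<Sum>i<n. x (h, i) * B $$ (j, i)))"
  have "kernel_app ?I (trace_kernel A B) x = (\<lambda>kj. T1 kj + T2 kj)"
    unfolding T1_def T2_def by (auto simp: kernel_app_trace_kernel)
  then have "L2_set (kernel_app ?I (trace_kernel A B) x) ?I \<le> L2_set T1 ?I + L2_set T2 ?I"
    using L2_set_triangle_ineq[of T1 T2 ?I] by simp
  moreover have "L2_set T1 ?I \<le> spectral_norm A * spectral_norm B * L2_set x ?I"
    unfolding T1_def by (rule op_bounded_sandwich[OF a(2,1) b(2,1)])
  moreover have "L2_set T2 ?I \<le> spectral_norm A * spectral_norm B * L2_set x ?I"
    unfolding T2_def
    by (rule op_bounded_sandwich[OF op_bounded_transpose[OF a(2,1)] a(1) op_bounded_transpose[OF b(2,1)] b(1)])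
  ultimately show ?thesis by linarith
qed

lemma frobenius_norm_L2_set:
  assumes "x \<in> carrier_mat p n"
  shows "frobenius_norm x = L2_set (\<lambda>ij. x $$ ij) ({..<p} \<times> {..<n})"
  using assms unfolding frobenius_norm_def L2_set_def by (simp add: sum.cartesian_product case_prod_beta')

lemma mult_mat_entry:
  assumes "A \<in> carrier_mat p q" "B \<in> carrier_mat q n" "i < p" "j < n"
  shows "(A * B) $$ (i, j) = (\<Sum>k<q. A $$ (i, k) * B $$ (k, j))"
  using assms by (auto simp: scalar_prod_def lessThan_atLeast0 intro!: sum.cong)

text \<open>Both summands of the kernel pair with \<open>x\<close> to the same trace:
  \<open>tr1\<close>, the expansion of the matrix product, belongs to the transposed summand, and
  \<open>t\<close> to the other one. Hence the factor 1/2.\<close>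

lemma trace_quadratic_form:
  assumes A: "A \<in> carrier_mat p p" and B: "B \<in> carrier_mat n n" and x: "x \<in> carrier_mat p n"
  shows "mat_trace (B * transpose_mat x * A * x)
    = ip ({..<p} \<times> {..<n}) (\<lambda>ij. x $$ ij) (kernel_app ({..<p} \<times> {..<n}) (trace_kernel A B) (\<lambda>ij. x $$ ij)) / 2"
proof -
  define t where "t = (\<Sum>k<p. \<Sum>j<n. \<Sum>h<p. \<Sum>i<n. x $$ (k, j) * (A $$ (k, h) * (x $$ (h, i) * B $$ (i, j))))"
  have xt: "transpose_mat x \<in> carrier_mat n p" using x by simp
  have Bx: "B * transpose_mat x \<in> carrier_mat n p" using B xt by simp
  have BxA: "B * transpose_mat x * A \<in> carrier_mat n p" using Bx A by simp
  have "mat_trace (B * transpose_mat x * A * x) = (\<Sum>i<n. (B * transpose_mat x * A * x) $$ (i, i))"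
    unfolding mat_trace_def using B by simp
  also have "\<dots> = (\<Sum>i<n. \<Sum>h<p. (\<Sum>k<p. (\<Sum>j<n. B $$ (i, j) * x $$ (k, j)) * A $$ (k, h)) * x $$ (h, i))"
  proof (rule sum.cong[OF refl])
    fix i assume "i \<in> {..<n}"
    then have i: "i < n" by simp
    have "(B * transpose_mat x) $$ (i, k) = (\<Sum>j<n. B $$ (i, j) * x $$ (k, j))" if "k < p" for k
      using mult_mat_entry[OF B xt i that] x that by simp
    then have "(B * transpose_mat x * A) $$ (i, h) = (\<Sum>k<p. (\<Sum>j<n. B $$ (i, j) * x $$ (k, j)) * A $$ (k, h))" if "h < p" for h
      using mult_mat_entry[OF Bx A i that] by simp
    then show "(B * transpose_mat x * A * x) $$ (i, i)
      = (\<Sum>h<p. (\<Sum>k<p. (\<Sum>j<n. B $$ (i, j) * x $$ (k, j)) * A $$ (k, h)) * x $$ (h, i))"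
      using mult_mat_entry[OF BxA x i i] by simp
  qed
  also have "\<dots> = (\<Sum>i<n. \<Sum>h<p. \<Sum>k<p. \<Sum>j<n. x $$ (h, i) * (A $$ (k, h) * (x $$ (k, j) * B $$ (i, j))))"
    by (simp add: sum_distrib_left sum_distrib_right mult_ac)
  also have "\<dots> = (\<Sum>h<p. \<Sum>i<n. \<Sum>k<p. \<Sum>j<n. x $$ (h, i) * (A $$ (k, h) * (x $$ (k, j) * B $$ (i, j))))"
    by (rule sum.swap)
  finally have tr1: "mat_trace (B * transpose_mat x * A * x)
    = (\<Sum>k<p. \<Sum>j<n. \<Sum>h<p. \<Sum>i<n. x $$ (k, j) * (A $$ (h, k) * (x $$ (h, i) * B $$ (j, i))))" .
  define F where "F a b = x $$ a * (A $$ (fst a, fst b) * (x $$ b * B $$ (snd b, snd a)))" for a b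
  have nest: "(\<Sum>a\<in>{..<p} \<times> {..<n}. f a) = (\<Sum>k<p. \<Sum>j<n. f (k, j))" for f :: "nat \<times> nat \<Rightarrow> real"
    by (simp add: sum.cartesian_product case_prod_beta')
  have "t = (\<Sum>a\<in>{..<p} \<times> {..<n}. \<Sum>b\<in>{..<p} \<times> {..<n}. F a b)"
    unfolding t_def nest F_def by simp
  also have "\<dots> = (\<Sum>b\<in>{..<p} \<times> {..<n}. \<Sum>a\<in>{..<p} \<times> {..<n}. F a b)" by (rule sum.swap)
  also have "\<dots> = (\<Sum>h<p. \<Sum>i<n. \<Sum>k<p. \<Sum>j<n. x $$ (k, j) * (A $$ (k, h) * (x $$ (h, i) * B $$ (i, j))))"
    unfolding nest F_def by simp
  also have "\<dots> = mat_trace (B * transpose_mat x * A * x)"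
    unfolding tr1 by (simp add: mult_ac)
  finally have tr2: "t = mat_trace (B * transpose_mat x * A * x)" .
  have "ip ({..<p} \<times> {..<n}) (\<lambda>ij. x $$ ij) (kernel_app ({..<p} \<times> {..<n}) (trace_kernel A B) (\<lambda>ij. x $$ ij))
    = (\<Sum>k<p. \<Sum>j<n. x $$ (k, j) * kernel_app ({..<p} \<times> {..<n}) (trace_kernel A B) (\<lambda>ij. x $$ ij) (k, j))"
    unfolding ip_def by (simp add: sum.cartesian_product case_prod_beta')
  also have "\<dots> = t + mat_trace (B * transpose_mat x * A * x)"
    unfolding kernel_app_trace_kernel t_def tr1
    by (simp add: sum.distrib sum_distrib_left distrib_left)
  finally show ?thesis using tr2 by simp
qed

text \<open>Transposition changes the sign of \<open>Aa\<close> and \<open>Ba\<close>, so in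
  \<open>A x B + A^T x B^T\<close> the mixed terms cancel and the two pure terms double.\<close>

lemma gradient_norm_frobenius:
  assumes As: "As \<in> carrier_mat p p" "transpose_mat As = As"
    and Aa: "Aa \<in> carrier_mat p p" "transpose_mat Aa = - Aa"
    and Bs: "Bs \<in> carrier_mat n n" "transpose_mat Bs = Bs"
    and Ba: "Ba \<in> carrier_mat n n" "transpose_mat Ba = - Ba"
    and x: "x \<in> carrier_mat p n"
  shows "L2_set (kernel_app ({..<p} \<times> {..<n}) (trace_kernel (As + Aa) (Bs + Ba)) (\<lambda>ij. x $$ ij)) ({..<p} \<times> {..<n})
    = 2 * frobenius_norm (As * x * Bs + Aa * x * Ba)"
proof -
  let ?I = "{..<p} \<times> {..<n}"
  have sym: "S $$ (j, i) = S $$ (i, j)" if "S \<in> carrier_mat d d" "transpose_mat S = S" "i < d" "j < d"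
    for S :: "real mat" and d i j
    using that index_transpose_mat(1)[of i S j] by auto
  have anti: "S $$ (j, i) = - S $$ (i, j)" if "S \<in> carrier_mat d d" "transpose_mat S = - S" "i < d" "j < d"
    for S :: "real mat" and d i j
    using that index_transpose_mat(1)[of i S j] by auto
  have sandwich: "(A * x * B) $$ (k, j) = (\<Sum>h<p. \<Sum>i<n. A $$ (k, h) * x $$ (h, i) * B $$ (i, j))"
    if A: "A \<in> carrier_mat p p" and B: "B \<in> carrier_mat n n" and k: "k < p" and j: "j < n" for A B k j
  proof -
    have Ax: "A * x \<in> carrier_mat p n" using A x by simp
    have "(A * x * B) $$ (k, j) = (\<Sum>i<n. (\<Sum>h<p. A $$ (k, h) * x $$ (h, i)) * B $$ (i, j))"
      unfolding mult_mat_entry[OF Ax B k j] by (intro sum.cong refl) (simp add: mult_mat_entry[OF A x k])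
    also have "\<dots> = (\<Sum>i<n. \<Sum>h<p. A $$ (k, h) * x $$ (h, i) * B $$ (i, j))"
      by (simp add: sum_distrib_right)
    finally show ?thesis by (subst sum.swap)
  qed
  have C: "As * x * Bs + Aa * x * Ba \<in> carrier_mat p n" using As Aa Bs Ba x by simp
  have "kernel_app ?I (trace_kernel (As + Aa) (Bs + Ba)) (\<lambda>ij. x $$ ij) (k, j)
    = 2 * (As * x * Bs + Aa * x * Ba) $$ (k, j)" if k: "k < p" and j: "j < n" for k j
  proof -
    have "kernel_app ?I (trace_kernel (As + Aa) (Bs + Ba)) (\<lambda>ij. x $$ ij) (k, j)
      = (\<Sum>h<p. \<Sum>i<n. (As + Aa) $$ (k, h) * x $$ (h, i) * (Bs + Ba) $$ (i, j)
          + (As + Aa) $$ (h, k) * x $$ (h, i) * (Bs + Ba) $$ (j, i))"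
      unfolding kernel_app_trace_kernel by (simp add: sum.distrib sum_distrib_left mult_ac)
    also have "\<dots> = (\<Sum>h<p. \<Sum>i<n. 2 * (As $$ (k, h) * x $$ (h, i) * Bs $$ (i, j)
          + Aa $$ (k, h) * x $$ (h, i) * Ba $$ (i, j)))"
    proof (intro sum.cong refl)
      fix h i assume "h \<in> {..<p}" "i \<in> {..<n}"
      then have h: "h < p" and i: "i < n" by auto
      have "(As + Aa) $$ (k, h) = As $$ (k, h) + Aa $$ (k, h)"
        "(As + Aa) $$ (h, k) = As $$ (k, h) - Aa $$ (k, h)"
        "(Bs + Ba) $$ (i, j) = Bs $$ (i, j) + Ba $$ (i, j)"
        "(Bs + Ba) $$ (j, i) = Bs $$ (i, j) - Ba $$ (i, j)"
        using sym[OF As k h] anti[OF Aa k h] sym[OF Bs i j] anti[OF Ba i j] As Aa Bs Ba h i j k by auto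
      then show "(As + Aa) $$ (k, h) * x $$ (h, i) * (Bs + Ba) $$ (i, j)
          + (As + Aa) $$ (h, k) * x $$ (h, i) * (Bs + Ba) $$ (j, i)
        = 2 * (As $$ (k, h) * x $$ (h, i) * Bs $$ (i, j) + Aa $$ (k, h) * x $$ (h, i) * Ba $$ (i, j))"
        by (simp only:) (simp add: algebra_simps)
    qed
    also have "\<dots> = 2 * ((As * x * Bs) $$ (k, j) + (Aa * x * Ba) $$ (k, j))"
      unfolding sandwich[OF As(1) Bs(1) k j] sandwich[OF Aa(1) Ba(1) k j]
      by (simp add: sum.distrib sum_distrib_left distrib_left)
    also have "\<dots> = 2 * (As * x * Bs + Aa * x * Ba) $$ (k, j)"
      using As Aa Bs Ba x k j by simp
    finally show ?thesis .
  qed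
  then have "L2_set (kernel_app ?I (trace_kernel (As + Aa) (Bs + Ba)) (\<lambda>ij. x $$ ij)) ?I
    = L2_set (\<lambda>ij. 2 * (As * x * Bs + Aa * x * Ba) $$ ij) ?I"
    by (intro L2_set_cong) auto
  then show ?thesis unfolding frobenius_norm_L2_set[OF C] L2_set_abs_scale by simp
qed

section \<open>Transfer to random matrices\<close>

lemma is_median_cong:
  assumes "\<And>w. w \<in> space M \<Longrightarrow> f w = g w"
  shows "is_median M f m \<longleftrightarrow> is_median M g m"
proof -
  have "{w \<in> space M. f w \<ge> m} = {w \<in> space M. g w \<ge> m}" "{w \<in> space M. f w \<le> m} = {w \<in> space M. g w \<le> m}"
    using assms by auto
  then show ?thesis unfolding is_median_def by simp
qed

lemma is_median_zero:
  assumes "\<And>w. w \<in> space M \<Longrightarrow> f w = 0" "is_median M f m"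
  shows "m = 0"
proof -
  have "measure M {w \<in> space M. (0::real) \<ge> m} \<ge> 1 / 2" "measure M {w \<in> space M. (0::real) \<le> m} \<ge> 1 / 2"
    using assms is_median_cong[of M f "\<lambda>_. 0" m] unfolding is_median_def by auto
  then show ?thesis by (cases "m > 0"; cases "m < 0") auto
qed

lemma lipschitz1_mat_entries:
  assumes "lipschitz1 ({..<p} \<times> {..<n}) f"
  shows "lipschitz1_mat p n (\<lambda>x. f (\<lambda>ij. x $$ ij))"
  unfolding lipschitz1_mat_def
proof (intro ballI)
  fix x y :: "real mat" assume x: "x \<in> carrier_mat p n" and y: "y \<in> carrier_mat p n"
  have "frobenius_norm (x - y) = dst ({..<p} \<times> {..<n}) (\<lambda>ij. x $$ ij) (\<lambda>ij. y $$ ij)"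
    unfolding frobenius_norm_L2_set[OF minus_carrier_mat[OF y]] dst_def
    by (rule L2_set_cong) (use x y in auto)
  then show "\<bar>f (\<lambda>ij. x $$ ij) - f (\<lambda>ij. y $$ ij)\<bar> \<le> frobenius_norm (x - y)"
    using lipschitz1_abs[OF assms] by simp
qed

text \<open>Reading entries is linear only inside the index range; the Lipschitz assumption makes
  \<open>f\<close> blind to the entries outside.\<close>

lemma convex_mat_entries:
  assumes lip: "lipschitz1 ({..<p} \<times> {..<n}) f" and conv: "convex_fun f"
  shows "convex_mat p n (\<lambda>x. f (\<lambda>ij. x $$ ij))"
  unfolding convex_mat_def
proof (intro ballI allI impI)
  fix x y :: "real mat" and u v :: real
  assume x: "x \<in> carrier_mat p n" and y: "y \<in> carrier_mat p n" and uv: "u \<ge> 0" "v \<ge> 0" "u + v = 1"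
  have "dst ({..<p} \<times> {..<n}) (\<lambda>ij. (u \<cdot>\<^sub>m x + v \<cdot>\<^sub>m y) $$ ij) (\<lambda>ij. u * x $$ ij + v * y $$ ij) = 0"
    unfolding dst_def by (rule L2_set_0') (use x y in auto)
  then have "f (\<lambda>ij. (u \<cdot>\<^sub>m x + v \<cdot>\<^sub>m y) $$ ij) = f (\<lambda>ij. u * x $$ ij + v * y $$ ij)"
    using lipschitz1_abs[OF lip, of "\<lambda>ij. (u \<cdot>\<^sub>m x + v \<cdot>\<^sub>m y) $$ ij" "\<lambda>ij. u * x $$ ij + v * y $$ ij"] by simp
  also have "\<dots> \<le> u * f (\<lambda>ij. x $$ ij) + v * f (\<lambda>ij. y $$ ij)"
    using conv uv unfolding convex_fun_def by blast
  finally show "f (\<lambda>ij. (u \<cdot>\<^sub>m x + v \<cdot>\<^sub>m y) $$ ij) \<le> u * f (\<lambda>ij. x $$ ij) + v * f (\<lambda>ij. y $$ ij)" .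
qed

lemma concentrated_entries:
  fixes X :: "'w \<Rightarrow> real mat"
  assumes X: "random_matrix M p n X" and \<alpha>: "\<alpha> \<in> M_down" and conc: "concentrated M X F \<alpha>"
    and f: "lipschitz1 ({..<p} \<times> {..<n}) f" "(\<lambda>x. f (\<lambda>ij. x $$ ij)) \<in> F"
    and m: "is_median M (\<lambda>w. f (\<lambda>ij. X w $$ ij)) m" and u: "u \<in> \<alpha> s"
  shows "measure M {w \<in> space M. \<bar>f (\<lambda>ij. X w $$ ij) - m\<bar> > s} \<le> u"
proof -
  interpret prob_space M using X unfolding random_matrix_def by blast
  have [measurable]: "(\<lambda>w. f (\<lambda>ij. X w $$ ij)) \<in> borel_measurable M"
    by (rule lipschitz1_measurable[OF _ _ f(1)]) (use X in \<open>auto simp: random_matrix_def\<close>)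
  have "op_le (surv M (\<lambda>w. \<bar>f (\<lambda>ij. X w $$ ij) - m\<bar>)) \<alpha>"
    using conc f(2) m unfolding concentrated_def by fast
  then show ?thesis using u by (subst (asm) op_le_surv_iff[OF _ \<alpha>]) auto
qed

text \<open>Reduces the matrix statement to a tail estimate for diagonalized forms. The factor
  \<open>\<kappa> / 2\<close> appears because the parameter of \<open>bound_op\<close> is a median
  of \<open>\<kappa>\<close> times the Frobenius norm, while \<open>grad_norm\<close> is 2 times
  that norm.\<close>

lemma trace_concentratedI:
  fixes X :: "'w \<Rightarrow> real mat"
  assumes \<alpha>: "\<alpha> \<in> M_prob" and X: "random_matrix M p n X" and pos: "\<kappa> > 0" "\<mu> > 0"
    and tail: "\<And>r v lam K a m s u. random_vector M (\<lambda>w ij. X w $$ ij) ({..<p} \<times> {..<n}) r v lam K \<Longrightarrow>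
      is_median M (\<lambda>w. quad_form ({..<p} \<times> {..<n}) r v lam (\<lambda>ij. X w $$ ij)) a \<Longrightarrow>
      is_median M (\<lambda>w. grad_norm ({..<p} \<times> {..<n}) r v lam (\<lambda>ij. X w $$ ij)) m \<Longrightarrow>
      m \<ge> 0 \<Longrightarrow> s \<ge> 0 \<Longrightarrow> u \<in> \<alpha> s \<Longrightarrow>
      measure M {w \<in> space M. \<bar>quad_form ({..<p} \<times> {..<n}) r v lam (\<lambda>ij. X w $$ ij) - a\<bar>
        > \<kappa> / 2 * m * s + \<mu> * K * s\<^sup>2} \<le> \<kappa> * u"
  shows "trace_concentrated M p n X \<alpha> \<kappa> \<mu>"
  unfolding trace_concentrated_def
proof (intro ballI allI impI)
  fix A B As Aa Bs Ba mTr m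
  assume A: "A \<in> carrier_mat p p" and B: "B \<in> carrier_mat n n"
    and As: "As \<in> carrier_mat p p" and Aa: "Aa \<in> carrier_mat p p"
    and Bs: "Bs \<in> carrier_mat n n" and Ba: "Ba \<in> carrier_mat n n"
    and AA: "A = As + Aa" "transpose_mat As = As" "transpose_mat Aa = - Aa"
    and BB: "B = Bs + Ba" "transpose_mat Bs = Bs" "transpose_mat Ba = - Ba"
    and mTr: "is_median M (\<lambda>w. mat_trace (B * transpose_mat (X w) * A * X w)) mTr"
    and m: "is_median M (\<lambda>w. \<kappa> * frobenius_norm (As * X w * Bs + Aa * X w * Ba)) m"
  interpret prob_space M using X unfolding random_matrix_def by blast
  have XC: "X w \<in> carrier_mat p n" if "w \<in> space M" for w
    using X that unfolding random_matrix_def by blast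
  define I where "I = {..<p} \<times> {..<n}"
  define K where "K = spectral_norm A * spectral_norm B"
  define \<phi> where "\<phi> w = mat_trace (B * transpose_mat (X w) * A * X w)" for w
  define Y where "Y = (\<lambda>w ij. X w $$ ij)"
  have fin: "finite I" unfolding I_def by simp
  have Y_meas: "(\<lambda>w. Y w i) \<in> borel_measurable M" if "i \<in> I" for i
    using X that unfolding random_matrix_def I_def Y_def by auto
  have \<alpha>': "\<alpha> \<in> M_down" "op_Dom \<alpha> \<subseteq> {0..}" using \<alpha> unfolding M_prob_def by auto
  have K0: "K \<ge> 0" unfolding K_def
    using spectral_norm_bounded(1)[OF A] spectral_norm_bounded(1)[OF B] by simp
  have c: "\<mu> * spectral_norm A * spectral_norm B = \<mu> * K" unfolding K_def by simp
  have bound: "L2_set (kernel_app I (trace_kernel A B) x) I \<le> 2 * K * L2_set x I" for x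
    unfolding I_def K_def by (rule trace_kernel_bounded[OF A B])
  obtain r v lam where on: "orthonormal_family I r v"
    and form: "\<And>x. ip I x (kernel_app I (trace_kernel A B) x) = (\<Sum>k<r. lam k * (ip I (v k) x)\<^sup>2)"
    and grad: "\<And>x. L2_set (kernel_app I (trace_kernel A B) x) I = L2_set (\<lambda>k. lam k * ip I (v k) x) {..<r}"
    and lam: "\<And>k. k < r \<Longrightarrow> \<bar>lam k\<bar> \<le> 2 * K"
    using kernel_diagonalization[of I "trace_kernel A B" "2 * K" thesis]
      fin trace_kernel_sym bound by blast
  have \<phi>_eq: "\<phi> w = quad_form I r v lam (Y w)" if "w \<in> space M" for w
    unfolding \<phi>_def trace_quadratic_form[OF A B XC[OF that]] quad_form_def
    by (simp add: form[symmetric] I_def[symmetric] Y_def)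
  have \<psi>_eq: "2 * frobenius_norm (As * X w * Bs + Aa * X w * Ba) = grad_norm I r v lam (Y w)"
    if "w \<in> space M" for w
    using gradient_norm_frobenius[OF As AA(2) Aa AA(3) Bs BB(2) Ba BB(3) XC[OF that]] grad[of "Y w"]
    unfolding AA(1) BB(1) grad_norm_def I_def Y_def by simp
  have [measurable]: "\<phi> \<in> borel_measurable M"
    by (subst measurable_cong[OF \<phi>_eq]) (auto intro!: quad_form_measurable Y_meas)
  have a: "is_median M (\<lambda>w. quad_form I r v lam (Y w)) mTr"
    using mTr is_median_cong[of M \<phi> "\<lambda>w. quad_form I r v lam (Y w)" mTr] \<phi>_eq unfolding \<phi>_def by blast
  have "is_median M (\<lambda>w. \<kappa> / 2 * grad_norm I r v lam (Y w)) m"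
    using m by (subst is_median_cong[where g="\<lambda>w. \<kappa> * frobenius_norm (As * X w * Bs + Aa * X w * Ba)"])
      (simp add: \<psi>_eq[symmetric])
  then have m': "is_median M (\<lambda>w. grad_norm I r v lam (Y w)) (m / (\<kappa> / 2))"
    using pos by (subst (asm) is_median_scale) auto
  have m0: "m \<ge> 0"
  proof (rule ccontr)
    assume neg: "\<not> m \<ge> 0"
    have "\<not> \<kappa> * frobenius_norm (As * X w * Bs + Aa * X w * Ba) \<le> m" if "w \<in> space M" for w
    proof -
      have "frobenius_norm (As * X w * Bs + Aa * X w * Ba) \<ge> 0"
        using grad_norm_nonneg[of I r v lam "Y w"] \<psi>_eq[OF that] by linarith
      then have "0 \<le> \<kappa> * frobenius_norm (As * X w * Bs + Aa * X w * Ba)" using pos by simp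
      then show ?thesis using neg by linarith
    qed
    then have none: "{w \<in> space M. \<kappa> * frobenius_norm (As * X w * Bs + Aa * X w * Ba) \<le> m} = {}" by blast
    show False using m unfolding is_median_def none by simp
  qed
  have M_down: "bound_op \<kappa> \<alpha> m (\<mu> * K) \<in> M_down"
    using bound_op_M_down[OF \<alpha>' m0 _ pos(1)] pos K0 by simp
  have "prob {w \<in> space M. \<bar>\<phi> w - mTr\<bar> > t} \<le> u" if u: "u \<in> bound_op \<kappa> \<alpha> m (\<mu> * K) t" for t u
  proof (cases "K = 0")
    \<comment> \<open>With \<open>K = 0\<close> all eigenvalues vanish, so the form, its median and
      the median of the gradient norm are 0 and \<open>bound_op\<close> takes its degenerate
      value.\<close>
    case True
    have "grad_norm I r v lam x = 0" for x
      using bound[of x] grad[of x] L2_set_nonneg[of "\<lambda>k. lam k * ip I (v k) x" "{..<r}"] True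
      unfolding grad_norm_def by simp
    then have "m / (\<kappa> / 2) = 0" using is_median_zero[OF _ m'] by simp
    then have "m = 0" using pos by simp
    then have t: "t \<ge> 0" "u \<ge> 0" using u True unfolding bound_op_def by (auto split: if_splits)
    have "\<phi> w = 0" if "w \<in> space M" for w
      using \<phi>_eq[OF that] lam True unfolding quad_form_def by simp
    moreover from this have "mTr = 0" using is_median_zero[OF _ mTr] unfolding \<phi>_def by simp
    ultimately have none: "{w \<in> space M. \<bar>\<phi> w - mTr\<bar> > t} = {}" using t by auto
    show ?thesis unfolding none using t by simp
  next
    case False
    then have Kpos: "K > 0" using K0 by simp
    interpret rv: random_vector M Y I r v lam K
      by unfold_locales (use fin Y_meas on lam Kpos in auto)
    have "m \<noteq> 0 \<or> \<mu> * K \<noteq> 0" "\<mu> * K \<ge> 0" using Kpos pos by auto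
    then obtain s u' where s: "s \<ge> 0" "t = m * s + \<mu> * K * s\<^sup>2" "u' \<in> \<alpha> s" "u = \<kappa> * u'"
      using u bound_op_iff[OF \<alpha>'(2) m0] by blast
    have "prob {w \<in> space M. \<bar>quad_form I r v lam (Y w) - mTr\<bar>
        > \<kappa> / 2 * (m / (\<kappa> / 2)) * s + \<mu> * K * s\<^sup>2} \<le> \<kappa> * u'"
      unfolding I_def Y_def
      by (rule tail[OF rv.random_vector_axioms[unfolded I_def Y_def] a[unfolded I_def Y_def] m'[unfolded I_def Y_def] _ s(1,3)])
        (use m0 pos in simp)
    moreover have "{w \<in> space M. \<bar>\<phi> w - mTr\<bar> > t} = {w \<in> space M. \<bar>quad_form I r v lam (Y w) - mTr\<bar>
        > \<kappa> / 2 * (m / (\<kappa> / 2)) * s + \<mu> * K * s\<^sup>2}"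
      using pos \<phi>_eq unfolding s(2) by auto
    ultimately show ?thesis using s(4) by simp
  qed
  then have "op_le (surv M (\<lambda>w. \<bar>\<phi> w - mTr\<bar>)) (bound_op \<kappa> \<alpha> m (\<mu> * K))"
    by (subst op_le_surv_iff[OF _ M_down]) auto
  then show "op_le (surv M (\<lambda>w. \<bar>mat_trace (B * transpose_mat (X w) * A * X w) - mTr\<bar>))
      (bound_op \<kappa> \<alpha> m (\<mu> * spectral_norm A * spectral_norm B))"
    unfolding c \<phi>_def .
qed

lemma lipschitz_trace_concentrated:
  assumes \<alpha>: "\<alpha> \<in> M_prob" and X: "random_matrix M p n X"
    and conc: "concentrated M X {f. lipschitz1_mat p n f} \<alpha>"
  shows "trace_concentrated M p n X \<alpha> 2 3"
proof (rule trace_concentratedI[OF \<alpha> X])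
  let ?I = "{..<p} \<times> {..<n}" and ?Y = "\<lambda>w ij. X w $$ ij"
  fix r v lam K a m s u
  assume rv: "random_vector M ?Y ?I r v lam K"
    and a: "is_median M (\<lambda>w. quad_form ?I r v lam (?Y w)) a"
    and m: "is_median M (\<lambda>w. grad_norm ?I r v lam (?Y w)) m" and s: "s \<ge> 0" and u: "u \<in> \<alpha> s"
  have \<alpha>': "\<alpha> \<in> M_down" using \<alpha> unfolding M_prob_def by blast
  have "measure M {w \<in> space M. \<bar>quad_form ?I r v lam (?Y w) - a\<bar> > m * s + 3 * K * s\<^sup>2} \<le> 2 * u"
    by (rule random_vector.quad_form_concentration[OF rv _ a m s])
      (rule concentrated_entries[OF X \<alpha>' conc _ _ _ u], auto intro: lipschitz1_mat_entries)
  then show "measure M {w \<in> space M. \<bar>quad_form ?I r v lam (?Y w) - a\<bar> > 2 / 2 * m * s + 3 * K * s\<^sup>2} \<le> 2 * u"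
    by simp
qed auto

text \<open>The 10 is the factor of \<open>u\<close>, and 12 is 4 times 3. Since the 10 also
  multiplies the Frobenius norm, the linear term becomes \<open>10 / 2 * m * s\<close>, which
  dominates the required \<open>4 * m * s\<close>.\<close>

lemma convex_trace_concentrated:
  assumes \<alpha>: "\<alpha> \<in> M_prob" and X: "random_matrix M p n X"
    and conc: "concentrated M X {f. lipschitz1_mat p n f \<and> convex_mat p n f} \<alpha>"
  shows "trace_concentrated M p n X \<alpha> 10 12"
proof (rule trace_concentratedI[OF \<alpha> X])
  let ?I = "{..<p} \<times> {..<n}" and ?Y = "\<lambda>w ij. X w $$ ij"
  fix r v lam K a m s u
  assume rv: "random_vector M ?Y ?I r v lam K"
    and a: "is_median M (\<lambda>w. quad_form ?I r v lam (?Y w)) a"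
    and m: "is_median M (\<lambda>w. grad_norm ?I r v lam (?Y w)) m" and m0: "m \<ge> 0"
    and s: "s \<ge> 0" and u: "u \<in> \<alpha> s"
  interpret random_vector M ?Y ?I r v lam K by (rule rv)
  have \<alpha>': "\<alpha> \<in> M_down" using \<alpha> unfolding M_prob_def by blast
  have "prob {w \<in> space M. \<bar>quad_form ?I r v lam (?Y w) - a\<bar> > 10 / 2 * m * s + 12 * K * s\<^sup>2}
    \<le> prob {w \<in> space M. \<bar>quad_form ?I r v lam (?Y w) - a\<bar> > 4 * (m * s + 3 * K * s\<^sup>2)}"
  proof (rule finite_measure_mono)
    have "10 / 2 * m * s + 12 * K * s\<^sup>2 \<ge> 4 * (m * s + 3 * K * s\<^sup>2)"
      using mult_nonneg_nonneg[OF m0 s] by simp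
    then show "{w \<in> space M. \<bar>quad_form ?I r v lam (?Y w) - a\<bar> > 10 / 2 * m * s + 12 * K * s\<^sup>2}
      \<subseteq> {w \<in> space M. \<bar>quad_form ?I r v lam (?Y w) - a\<bar> > 4 * (m * s + 3 * K * s\<^sup>2)}"
      using order.strict_trans1 by blast
  qed measurable
  also have "\<dots> \<le> 10 * u"
    by (rule quad_form_convex_concentration[OF _ m s a])
      (rule concentrated_entries[OF X \<alpha>' conc _ _ _ u], auto intro: lipschitz1_mat_entries convex_mat_entries)
  finally show "prob {w \<in> space M. \<bar>quad_form ?I r v lam (?Y w) - a\<bar> > 10 / 2 * m * s + 12 * K * s\<^sup>2} \<le> 10 * u" .
qed auto

text \<open>The convex claim is made for \<open>'w\<close> and for \<open>real mat\<close> with the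
  same constants, because the type \<open>'w\<close> is fixed outside the existential quantifiers:
  the law of a random matrix can be carried by \<open>real mat\<close>, so the constants cannot
  depend on \<open>'w\<close>.\<close>

theorem theorem2p54:
  shows "(\<forall>(p::nat) (n::nat) \<alpha> (M :: 'w measure) X.
            p > 0 \<longrightarrow> n > 0 \<longrightarrow> \<alpha> \<in> M_prob \<longrightarrow> random_matrix M p n X \<longrightarrow>
            concentrated M X {f. lipschitz1_mat p n f} \<alpha> \<longrightarrow>
            trace_concentrated M p n X \<alpha> 2 3)
       \<and> (\<exists>\<kappa> > 0. \<exists>\<mu> > 0.
            (\<forall>(p::nat) (n::nat) \<alpha> (M :: 'w measure) X.
               p > 0 \<longrightarrow> n > 0 \<longrightarrow> \<alpha> \<in> M_prob \<longrightarrow> random_matrix M p n X \<longrightarrow>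
               concentrated M X {f. lipschitz1_mat p n f \<and> convex_mat p n f} \<alpha> \<longrightarrow>
               trace_concentrated M p n X \<alpha> \<kappa> \<mu>) \<and>
            (\<forall>(p::nat) (n::nat) \<alpha> (M :: real mat measure) X.
               p > 0 \<longrightarrow> n > 0 \<longrightarrow> \<alpha> \<in> M_prob \<longrightarrow> random_matrix M p n X \<longrightarrow>
               concentrated M X {f. lipschitz1_mat p n f \<and> convex_mat p n f} \<alpha> \<longrightarrow>
               trace_concentrated M p n X \<alpha> \<kappa> \<mu>))"
  by (rule conjI, blast intro: lipschitz_trace_concentrated, rule exI[of _ "10::real"], rule conjI,
      simp, rule exI[of _ "12::real"], intro conjI) (simp | blast intro: convex_trace_concentrated)+

end
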